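(* Let $\Sigma$ be a regular surface in $\mathbb{R}^3$ which is homeomorphic to the plane $\mathbb{R}^2$ and whose Gauss curvature satisfies $K<0$ everywhere. Then there are no closed asymptotic curves on $\Sigma$.
   Context: A regular surface in $\mathbb{R}^3$ is a smooth 2-dimensional manifold $\Sigma$ together with a smooth immersion into $\mathbb{R}^3$; it carries the induced metric (first fundamental form) and, with respect to a local unit normal $n$, the second fundamental form $\mathrm{II}$. Topological statements (such as "homeomorphic to a plane") refer to the 2-manifold $\Sigma$, and a curve on $\Sigma$ is a curve in the 2-manifold $\Sigma$. An asymptotic curve is a smooth regular curve $\alpha$ on $\Sigma$ whose normal curvature vanishes everywhere, i.e. $\mathrm{II}(\dot\alpha,\dot\alpha)=0$ along $\alpha$. A closed asymptotic curve is an asymptotic curve which is closed, i.e. a smooth regular map from a circle $\mathbb{R}/\ell\mathbb{Z}$ to $\Sigma$ that is asymptotic at every point. *)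

theory Defs
  imports "HOL-Analysis.Analysis"
begin

text \<open>\<^term>\<open>S\<close> is meant to be open: derivatives are taken at points, not within \<^term>\<open>S\<close>. On open
  subsets of Euclidean space this is the usual class of \<open>k\<close> times continuously differentiable maps.\<close>

primrec Ck_on :: "nat \<Rightarrow> ('a::real_normed_vector \<Rightarrow> 'b::real_normed_vector) \<Rightarrow> 'a set \<Rightarrow> bool" where
  "Ck_on 0 f S \<longleftrightarrow> continuous_on S f"
| "Ck_on (Suc k) f S \<longleftrightarrow> (\<forall>x\<in>S. f differentiable (at x)) \<and>
     (\<forall>v. Ck_on k (\<lambda>x. frechet_derivative f (at x) v) S)"

definition smooth_on :: "('a::real_normed_vector \<Rightarrow> 'b::real_normed_vector) \<Rightarrow> 'a set \<Rightarrow> bool" where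
  "smooth_on f S \<longleftrightarrow> open S \<and> (\<forall>k. Ck_on k f S)"

text \<open>A chart is a pair of a domain and a coordinate map; the values of the coordinate map
  outside the domain are irrelevant.\<close>

type_synonym 'a chart = "'a set \<times> ('a \<Rightarrow> real^2)"

definition is_chart :: "'a topology \<Rightarrow> 'a chart \<Rightarrow> bool" where
  "is_chart X = (\<lambda>(U, \<phi>). openin X U \<and> open (\<phi> ` U) \<and>
     homeomorphic_map (subtopology X U) (top_of_set (\<phi> ` U)) \<phi>)"

text \<open>The smooth structure is given by an atlas, which need not be maximal.\<close>

definition smooth_surface :: "'a topology \<Rightarrow> 'a chart set \<Rightarrow> bool" where
  "smooth_surface X A \<longleftrightarrow>
     Hausdorff_space X \<and> second_countable X \<and>
     (\<forall>c\<in>A. is_chart X c) \<and>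
     (\<Union>(U, \<phi>)\<in>A. U) = topspace X \<and>
     (\<forall>(U, \<phi>)\<in>A. \<forall>(V, \<psi>)\<in>A. smooth_on (\<psi> \<circ> inv_into U \<phi>) (\<phi> ` (U \<inter> V)))"

definition local_param :: "('a \<Rightarrow> real^3) \<Rightarrow> 'a chart \<Rightarrow> real^2 \<Rightarrow> real^3" where
  "local_param f = (\<lambda>(U, \<phi>). f \<circ> inv_into U \<phi>)"

definition smooth_immersion :: "'a chart set \<Rightarrow> ('a \<Rightarrow> real^3) \<Rightarrow> bool" where
  "smooth_immersion A f \<longleftrightarrow>
     (\<forall>(U, \<phi>)\<in>A. smooth_on (local_param f (U, \<phi>)) (\<phi> ` U) \<and>
        (\<forall>x\<in>\<phi> ` U. inj (frechet_derivative (local_param f (U, \<phi>)) (at x))))"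

definition regular_surface :: "'a topology \<Rightarrow> 'a chart set \<Rightarrow> ('a \<Rightarrow> real^3) \<Rightarrow> bool" where
  "regular_surface X A f \<longleftrightarrow> smooth_surface X A \<and> smooth_immersion A f"

text \<open>In the following, \<^term>\<open>r\<close> is a local parametrization and \<^term>\<open>v\<close>, \<^term>\<open>w\<close> are tangent
  vectors in the corresponding coordinates.\<close>

definition first_form :: "(real^2 \<Rightarrow> real^3) \<Rightarrow> real^2 \<Rightarrow> real^2 \<Rightarrow> real^2 \<Rightarrow> real" where
  "first_form r x v w = frechet_derivative r (at x) v \<bullet> frechet_derivative r (at x) w"

definition unit_normal :: "(real^2 \<Rightarrow> real^3) \<Rightarrow> real^2 \<Rightarrow> real^3" where
  "unit_normal r x =
     sgn (cross3 (frechet_derivative r (at x) (axis 1 1)) (frechet_derivative r (at x) (axis 2 1)))"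

text \<open>The normal component of the second derivative of \<^term>\<open>r\<close>. Coordinate changes affect it
  only by the sign of the normal.\<close>

definition second_form :: "(real^2 \<Rightarrow> real^3) \<Rightarrow> real^2 \<Rightarrow> real^2 \<Rightarrow> real^2 \<Rightarrow> real" where
  "second_form r x v w =
     frechet_derivative (\<lambda>y. frechet_derivative r (at y) v) (at x) w \<bullet> unit_normal r x"

definition form_matrix :: "(real^2 \<Rightarrow> real^2 \<Rightarrow> real) \<Rightarrow> real^2^2" where
  "form_matrix b = (\<chi> i j. b (axis i 1) (axis j 1))"

definition gauss_curvature :: "(real^2 \<Rightarrow> real^3) \<Rightarrow> real^2 \<Rightarrow> real" where
  "gauss_curvature r x = det (form_matrix (second_form r x)) / det (form_matrix (first_form r x))"

definition regular_curve :: "'a topology \<Rightarrow> 'a chart set \<Rightarrow> real set \<Rightarrow> (real \<Rightarrow> 'a) \<Rightarrow> bool" where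
  "regular_curve X A I \<alpha> \<longleftrightarrow> open I \<and> continuous_map (top_of_set I) X \<alpha> \<and>
     (\<forall>(U, \<phi>)\<in>A. smooth_on (\<phi> \<circ> \<alpha>) {t\<in>I. \<alpha> t \<in> U} \<and>
        (\<forall>t\<in>I. \<alpha> t \<in> U \<longrightarrow> vector_derivative (\<phi> \<circ> \<alpha>) (at t) \<noteq> 0))"

definition asymptotic_curve ::
    "'a topology \<Rightarrow> 'a chart set \<Rightarrow> ('a \<Rightarrow> real^3) \<Rightarrow> real set \<Rightarrow> (real \<Rightarrow> 'a) \<Rightarrow> bool" where
  "asymptotic_curve X A f I \<alpha> \<longleftrightarrow> regular_curve X A I \<alpha> \<and>
     (\<forall>(U, \<phi>)\<in>A. \<forall>t\<in>I. \<alpha> t \<in> U \<longrightarrow>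
        (let v = vector_derivative (\<phi> \<circ> \<alpha>) (at t)
         in second_form (local_param f (U, \<phi>)) (\<phi> (\<alpha> t)) v v = 0))"

text \<open>Maps from the circle \<open>\<real>/l\<int>\<close> are represented by \<^term>\<open>l\<close>-periodic maps on the real line.
  Neither minimality of the period nor simplicity of the curve is required.\<close>

definition closed_asymptotic_curve ::
    "'a topology \<Rightarrow> 'a chart set \<Rightarrow> ('a \<Rightarrow> real^3) \<Rightarrow> real \<Rightarrow> (real \<Rightarrow> 'a) \<Rightarrow> bool" where
  "closed_asymptotic_curve X A f l \<alpha> \<longleftrightarrow>
     l > 0 \<and> (\<forall>t. \<alpha> (t + l) = \<alpha> t) \<and> asymptotic_curve X A f UNIV \<alpha>"

end

theory Submission
  imports Defs
begin

text \<open>Since the Gauss curvature is negative, the second fundamental form is indefinite at every point,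
and there are exactly two asymptotic lines in each tangent plane.  For an asymptotic vector \<open>v\<close>
the linear form \<open>II(v, \<cdot>)\<close> vanishes on \<open>v\<close>, so it is \<open>c\<close> times the area of the parallelogram
spanned by \<open>v\<close> and the argument, and the sign of \<open>c\<close> tells the two lines apart.  Reversing the
orientation of the coordinates reverses both the normal and the area, so this sign, the type of
\<open>v\<close>, does not depend on the chart.  Hence there are two continuous line fields on the surface, and
a connected asymptotic curve is tangent to one of them throughout.  Because the surface is
homeomorphic to a plane, the line field can be oriented by a unit field \<open>u\<close> over any given disc,
and after a choice of sign a closed asymptotic curve runs in the direction of \<open>u\<close>.  So it
suffices to see that a nowhere vanishing direction field in the plane has no closed curve along it.

A smooth closed curve along such a field contains a shortest loop.  This loop \<open>b\<close> is simple, and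
at its base point it may have a corner, but it still runs in the direction of \<open>u\<close>.  On the one
hand, the vector \<open>b(t + \<epsilon>) - b(t)\<close> turns an odd number of times around the origin, by Hopf's
argument for the rotation number (\<open>chords_of_simple_loop_no_periodic_log\<close>).  On the other
hand, a small displacement \<open>G \<epsilon>\<close> in the direction of \<open>u\<close> moves every point of a disc around the
loop, so \<open>G \<epsilon> p - p\<close> has a continuous logarithm on the disc and does not turn along the loop.
The two loops of vectors are homotopic in the punctured plane through
\<open>G (s \<epsilon>) (b(t + (1 - s) \<epsilon>)) - b(t)\<close>, which never vanishes because both motions go forward along \<open>u\<close>
(\<open>no_simple_advancing_loop\<close>).  This is a contradiction.

The homeomorphism of the surface with the plane need not be smooth, and the argument is arranged
accordingly.  Winding is measured in the topological plane, whereas forward motion is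
measured in space: a point moves forward if its image under the immersion gains in the direction
of \<open>u\<close>.  Gains add up under composition, so \<open>G\<close> can be composed of displacements supported in
single charts, where each of them is a translation damped by a bump function
(\<open>chart_displacement\<close>, \<open>compact_strictly_advancing\<close>).\<close>

section \<open>Winding of the chords of a simple loop\<close>

lemma exp_eq_imp_diff_int_pi:
  fixes z w :: complex
  shows "exp z = exp w \<Longrightarrow> \<exists>m::int. even m \<and> z - w = of_int m * (of_real pi * \<i>)"
    and "exp z = - exp w \<Longrightarrow> \<exists>m::int. odd m \<and> z - w = of_int m * (of_real pi * \<i>)"
proof -
  assume "exp z = exp w"
  then obtain n :: int where "z = w + (of_int (2 * n) * pi) * \<i>"
    by (auto simp: exp_eq)
  then show "\<exists>m::int. even m \<and> z - w = of_int m * (of_real pi * \<i>)"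
    by (intro exI[of _ "2 * n"]) simp
next
  assume "exp z = - exp w"
  then have "exp z = exp (w + of_real pi * \<i>)"
    by (simp add: exp_add mult.commute)
  then obtain n :: int where "z = w + of_real pi * \<i> + (of_int (2 * n) * pi) * \<i>"
    by (auto simp: exp_eq)
  then show "\<exists>m::int. odd m \<and> z - w = of_int m * (of_real pi * \<i>)"
    by (intro exI[of _ "2 * n + 1"]) (simp add: algebra_simps)
qed

text \<open>Differences of two logarithms of the same function, or of opposite functions, are integer multiples
of \<open>\<pi> \<i>\<close>; the predicate \<open>P\<close> records the parity of the multiple.\<close>

lemma int_pi_valued_constant:
  fixes f :: "'a::topological_space \<Rightarrow> complex" and P :: "int \<Rightarrow> bool"
  assumes "connected S" "S \<noteq> {}" "continuous_on S f"
    and int: "\<And>x. x \<in> S \<Longrightarrow> \<exists>m::int. P m \<and> f x = of_int m * (of_real pi * \<i>)"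
  obtains m where "P m" "\<And>x. x \<in> S \<Longrightarrow> f x = of_int m * (of_real pi * \<i>)"
proof -
  have "f constant_on S"
  proof (rule continuous_discrete_range_constant[OF assms(1,3)])
    fix x assume "x \<in> S"
    then obtain m :: int where m: "f x = of_int m * (of_real pi * \<i>)" using int[OF \<open>x \<in> S\<close>] by blast
    have "pi \<le> norm (f y - f x)" if y: "y \<in> S" "f y \<noteq> f x" for y
    proof -
      obtain n :: int where n: "f y = of_int n * (of_real pi * \<i>)" using int[OF y(1)] by blast
      have "n \<noteq> m" using y m n by auto
      then have "1 \<le> \<bar>real_of_int (n - m)\<bar>" by linarith
      moreover have "f y - f x = of_int (n - m) * (of_real pi * \<i>)"
        using m n by (simp add: algebra_simps)
      then have "norm (f y - f x) = \<bar>real_of_int (n - m)\<bar> * pi"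
        by (simp only: norm_mult norm_of_int norm_of_real norm_ii) simp
      ultimately show ?thesis using pi_gt_zero by simp
    qed
    then show "\<exists>e>0. \<forall>y. y \<in> S \<and> f y \<noteq> f x \<longrightarrow> e \<le> norm (f y - f x)"
      using pi_gt_zero by blast
  qed
  then obtain c where c: "\<And>x. x \<in> S \<Longrightarrow> f x = c" unfolding constant_on_def by blast
  obtain x where "x \<in> S" using assms(2) by blast
  then show ?thesis using int[of x] c that by metis
qed

text \<open>This is Hopf's argument.  The chord \<open>b t - b s\<close> does not vanish on the triangle
\<open>0 \<le> s < t \<le> T\<close> away from its corner \<open>(0, T)\<close>, so it has a logarithm \<open>\<theta>\<close> on the trapezoid \<open>C\<close> cut
out of the triangle.  A periodic logarithm of \<open>b (t + \<delta>) - b t\<close> agrees with \<open>\<theta>\<close> up to an even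
multiple of \<open>\<pi> \<i>\<close> along the side \<open>t - s = \<delta>\<close> and, after \<open>t + \<delta>\<close> has passed the end of the period,
up to an odd multiple along the side \<open>t - s = T - \<delta>\<close>, where the chord is run through backwards.  On
the two remaining sides, \<open>s = 0\<close> and \<open>t = T\<close>, the chords are opposite, which gives a third, odd
multiple.  Comparing the values at the four corners of \<open>C\<close> forces that odd multiple to be zero.\<close>

lemma chords_of_simple_loop_no_periodic_log:
  fixes b l :: "real \<Rightarrow> complex"
  assumes \<delta>: "0 < \<delta>" "2 * \<delta> \<le> T"
    and contb: "continuous_on {0..T} b"
    and per: "\<And>t. t \<in> {0..T} \<Longrightarrow> b (t + T) = b t"
    and inj: "inj_on b {0..<T}"
    and contl: "continuous_on {0..T} l"
    and expl: "\<And>t. t \<in> {0..T} \<Longrightarrow> exp (l t) = b (t + \<delta>) - b t"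
  shows "l T \<noteq> l 0"
proof
  assume closed: "l T = l 0"
  define c where "c = of_real pi * \<i>"
  have c0: "c \<noteq> 0" by (simp add: c_def)
  define C where "C = {(s,t). 0 \<le> s \<and> t \<le> T \<and> \<delta> \<le> t - s \<and> t - s \<le> T - \<delta>}"
  have bT: "b T = b 0" using per[of 0] \<delta> by simp
  have "C = fst -` {0..} \<inter> snd -` {..T} \<inter> (\<lambda>p. snd p - fst p) -` {\<delta>..T-\<delta>}"
    by (auto simp: C_def)
  moreover have "convex (fst -` {0::real..} \<inter> snd -` {..T} \<inter> (\<lambda>p. snd p - fst p) -` {\<delta>..T-\<delta>})"
    by (intro convex_Int convex_linear_vimage linear_fst linear_snd linear_compose_sub) auto
  ultimately have "convex C" by simp
  have cont: "continuous_on C (\<lambda>p. b (snd p) - b (fst p))"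
    by (intro continuous_intros continuous_on_compose2[OF contb]) (use \<delta> in \<open>auto simp: C_def\<close>)
  have nz: "b (snd p) - b (fst p) \<noteq> 0" if "p \<in> C" for p
  proof -
    obtain s t where p: "p = (s,t)" by force
    have st: "0 \<le> s" "t \<le> T" "\<delta> \<le> t - s" "t - s \<le> T - \<delta>" using that by (auto simp: C_def p)
    show ?thesis
    proof (cases "t = T")
      case True
      then show ?thesis using inj_onD[OF inj, of 0 s] st \<delta> bT by (auto simp: p)
    next
      case False
      then show ?thesis using inj_onD[OF inj, of t s] st \<delta> by (auto simp: p)
    qed
  qed
  obtain \<theta> where \<theta>: "continuous_on C \<theta>" "\<And>p. p \<in> C \<Longrightarrow> b (snd p) - b (fst p) = exp (\<theta> p)"
    using continuous_logarithm_on_contractible[OF cont convex_imp_contractible[OF \<open>convex C\<close>]] nz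
    by blast
  \<comment> \<open>The sides \<open>s = 0\<close> and \<open>t = T\<close> of the trapezoid, on which the chords are opposite.\<close>
  obtain m where m: "odd m" "\<And>s. s \<in> {\<delta>..T-\<delta>} \<Longrightarrow> \<theta> (s,T) - \<theta> (0,s) = of_int m * c"
  proof (rule int_pi_valued_constant[of "{\<delta>..T-\<delta>}" "\<lambda>s. \<theta> (s,T) - \<theta> (0,s)" odd])
    show "continuous_on {\<delta>..T-\<delta>} (\<lambda>s. \<theta> (s,T) - \<theta> (0,s))"
      by (intro continuous_intros continuous_on_compose2[OF \<theta>(1)]) (use \<delta> in \<open>auto simp: C_def\<close>)
    fix s assume "s \<in> {\<delta>..T-\<delta>}"
    then have "(s,T) \<in> C" "(0,s) \<in> C" using \<delta> by (auto simp: C_def)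
    from \<theta>(2)[OF this(1)] \<theta>(2)[OF this(2)] bT
    have "exp (\<theta> (s,T)) = - exp (\<theta> (0,s))" by (metis fst_conv snd_conv minus_diff_eq)
    then show "\<exists>m. odd m \<and> \<theta> (s,T) - \<theta> (0,s) = of_int m * (of_real pi * \<i>)"
      by (rule exp_eq_imp_diff_int_pi(2))
  qed (use \<delta> c_def in auto)
  \<comment> \<open>The side \<open>t - s = \<delta>\<close>.\<close>
  obtain k where k: "even k" "\<And>t. t \<in> {0..T-\<delta>} \<Longrightarrow> l t - \<theta> (t,t+\<delta>) = of_int k * c"
  proof (rule int_pi_valued_constant[of "{0..T-\<delta>}" "\<lambda>t. l t - \<theta> (t,t+\<delta>)" even])
    show "continuous_on {0..T-\<delta>} (\<lambda>t. l t - \<theta> (t,t+\<delta>))"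
      by (intro continuous_intros continuous_on_compose2[OF \<theta>(1)] continuous_on_subset[OF contl])
         (use \<delta> in \<open>auto simp: C_def\<close>)
    fix t assume t: "t \<in> {0..T-\<delta>}"
    then have "(t,t+\<delta>) \<in> C" using \<delta> by (auto simp: C_def)
    from \<theta>(2)[OF this] expl[of t] t \<delta> have "exp (l t) = exp (\<theta> (t,t+\<delta>))" by auto
    then show "\<exists>m. even m \<and> l t - \<theta> (t,t+\<delta>) = of_int m * (of_real pi * \<i>)"
      by (rule exp_eq_imp_diff_int_pi(1))
  qed (use \<delta> c_def in auto)
  \<comment> \<open>The side \<open>t - s = T - \<delta>\<close>.\<close>
  obtain n where n: "odd n" "\<And>t. t \<in> {T-\<delta>..T} \<Longrightarrow> l t - \<theta> (t+\<delta>-T,t) = of_int n * c"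
  proof (rule int_pi_valued_constant[of "{T-\<delta>..T}" "\<lambda>t. l t - \<theta> (t+\<delta>-T,t)" odd])
    show "continuous_on {T-\<delta>..T} (\<lambda>t. l t - \<theta> (t+\<delta>-T,t))"
      by (intro continuous_intros continuous_on_compose2[OF \<theta>(1)] continuous_on_subset[OF contl])
         (use \<delta> in \<open>auto simp: C_def\<close>)
    fix t assume t: "t \<in> {T-\<delta>..T}"
    then have "(t+\<delta>-T,t) \<in> C" using \<delta> by (auto simp: C_def)
    moreover have "b (t + \<delta>) = b (t+\<delta>-T)" using per[of "t+\<delta>-T"] t \<delta> by auto
    ultimately have "exp (l t) = - exp (\<theta> (t+\<delta>-T,t))"
      using \<theta>(2)[of "(t+\<delta>-T,t)"] expl[of t] t \<delta> by (metis (no_types, lifting) atLeastAtMost_iff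
          diff_ge_0_iff_ge dual_order.trans fst_conv minus_diff_eq mult_2 order_less_imp_le snd_conv add_increasing2 le_diff_eq)
    then show "\<exists>m. odd m \<and> l t - \<theta> (t+\<delta>-T,t) = of_int m * (of_real pi * \<i>)"
      by (rule exp_eq_imp_diff_int_pi(2))
  qed (use \<delta> c_def in auto)
  have "\<theta> (\<delta>,T) + of_int n * c = \<theta> (0,\<delta>) + of_int k * c"
    using k(2)[of 0] n(2)[of T] closed \<delta> by (simp add: algebra_simps)
  with m(2)[of \<delta>] \<delta> have "of_int (m + n) * c = of_int k * c"
    by (simp add: algebra_simps)
  then have 1: "m + n = k" using c0 by (metis mult_right_cancel of_int_eq_iff)
  have "\<theta> (T-\<delta>,T) + of_int k * c = \<theta> (0,T-\<delta>) + of_int n * c"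
    using k(2)[of "T-\<delta>"] n(2)[of "T-\<delta>"] \<delta> by (simp add: algebra_simps)
  with m(2)[of "T-\<delta>"] \<delta> have "of_int (m + k) * c = of_int n * c"
    by (simp add: algebra_simps)
  then have "m + k = n" using c0 by (metis mult_right_cancel of_int_eq_iff)
  with 1 have "m = 0" by simp
  with m(1) show False by simp
qed

lemma compact_uniform_scale:
  fixes C :: "'a::metric_space set"
  assumes "compact C"
    and loc: "\<And>x. x \<in> C \<Longrightarrow> \<exists>d>0. \<forall>y\<in>C. \<forall>\<epsilon>. dist y x < d \<and> 0 < \<epsilon> \<and> \<epsilon> < d \<longrightarrow> P \<epsilon> y"
  shows "\<exists>d>(0::real). \<forall>y\<in>C. \<forall>\<epsilon>. 0 < \<epsilon> \<and> \<epsilon> < d \<longrightarrow> P \<epsilon> y"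
proof -
  from loc have "\<forall>x\<in>C. \<exists>d. d > 0 \<and> (\<forall>y\<in>C. \<forall>\<epsilon>. dist y x < d \<and> 0 < \<epsilon> \<and> \<epsilon> < d \<longrightarrow> P \<epsilon> y)"
    by blast
  from bchoice[OF this] obtain d where
    "\<forall>x\<in>C. d x > 0 \<and> (\<forall>y\<in>C. \<forall>\<epsilon>. dist y x < d x \<and> 0 < \<epsilon> \<and> \<epsilon> < d x \<longrightarrow> P \<epsilon> y)"
    by blast
  then have d: "\<And>x. x \<in> C \<Longrightarrow> d x > 0"
    "\<And>x y \<epsilon>. x \<in> C \<Longrightarrow> y \<in> C \<Longrightarrow> dist y x < d x \<Longrightarrow> 0 < \<epsilon> \<Longrightarrow> \<epsilon> < d x \<Longrightarrow> P \<epsilon> y"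
    by blast+
  obtain D where D: "D \<subseteq> C" "finite D" "C \<subseteq> (\<Union>x\<in>D. ball x (d x))"
  proof (rule compactE_image[OF assms(1), of C "\<lambda>x. ball x (d x)"])
    show "C \<subseteq> (\<Union>x\<in>C. ball x (d x))" using d(1) by force
  qed auto
  show ?thesis
  proof (intro exI conjI ballI allI impI)
    show "Min (insert 1 (d ` D)) > 0" using D d(1) by (subst Min_gr_iff) auto
    fix y \<epsilon> assume y: "y \<in> C" and e: "0 < \<epsilon> \<and> \<epsilon> < Min (insert 1 (d ` D))"
    obtain x where x: "x \<in> D" "y \<in> ball x (d x)" using D y by blast
    have "Min (insert 1 (d ` D)) \<le> d x" using x D by (intro Min_le) auto
    then have "\<epsilon> < d x" using e by simp
    moreover have "dist y x < d x" using x by (simp add: dist_commute)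
    ultimately show "P \<epsilon> y" using d(2)[of x y \<epsilon>] x D y e by blast
  qed
qed

section \<open>Displacements along a vector field\<close>

text \<open>A displacement \<open>G\<close> moves \<open>q\<close> to \<open>G \<epsilon> q\<close>, and progress is measured by the gain of \<open>F\<close> in the direction
\<open>u\<close>.  The direction is frozen at the limit point \<open>p\<close>, whereas \<open>q\<close> ranges over a neighbourhood of \<open>p\<close>:
in this form gains add up exactly when displacements are composed.\<close>

definition weakly_advances :: "('a::metric_space \<Rightarrow> 'b::real_inner) \<Rightarrow> ('a \<Rightarrow> 'b) \<Rightarrow> (real \<Rightarrow> 'a \<Rightarrow> 'a) \<Rightarrow> 'a \<Rightarrow> bool" where
  "weakly_advances F u G p \<longleftrightarrow>
     (\<exists>d>0. \<forall>\<epsilon> q. 0 \<le> \<epsilon> \<and> \<epsilon> < d \<and> dist q p < d \<longrightarrow> 0 \<le> (F (G \<epsilon> q) - F q) \<bullet> u p)"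

definition strictly_advances :: "('a::metric_space \<Rightarrow> 'b::real_inner) \<Rightarrow> ('a \<Rightarrow> 'b) \<Rightarrow> (real \<Rightarrow> 'a \<Rightarrow> 'a) \<Rightarrow> 'a \<Rightarrow> bool" where
  "strictly_advances F u G p \<longleftrightarrow>
     (\<exists>d>0. \<forall>\<epsilon> q. 0 < \<epsilon> \<and> \<epsilon> < d \<and> dist q p < d \<longrightarrow> 0 < (F (G \<epsilon> q) - F q) \<bullet> u p)"

definition displacement :: "(real \<Rightarrow> 'a::topological_space \<Rightarrow> 'a) \<Rightarrow> bool" where
  "displacement G \<longleftrightarrow> continuous_on UNIV (\<lambda>(\<epsilon>, q). G \<epsilon> q) \<and> (\<forall>q. G 0 q = q)"

lemma displacement_near:
  fixes G :: "real \<Rightarrow> 'a::metric_space \<Rightarrow> 'a"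
  assumes "displacement G" "e > 0"
  shows "\<exists>d>0. \<forall>\<epsilon> q. 0 \<le> \<epsilon> \<and> \<epsilon> < d \<and> dist q p < d \<longrightarrow> dist (G \<epsilon> q) p < e"
proof -
  have "continuous (at (0, p)) (\<lambda>(\<epsilon>, q). G \<epsilon> q)"
    using assms by (simp add: displacement_def continuous_on_eq_continuous_at)
  then obtain d where d: "d > 0"
    "\<And>x. dist x (0, p) < d \<Longrightarrow> dist (case x of (\<epsilon>, q) \<Rightarrow> G \<epsilon> q) (G 0 p) < e"
    unfolding continuous_at_eps_delta using \<open>e > 0\<close> by fastforce
  show ?thesis
  proof (intro exI conjI allI impI)
    show "d / 2 > 0" using d by simp
    fix \<epsilon> :: real and q assume "0 \<le> \<epsilon> \<and> \<epsilon> < d / 2 \<and> dist q p < d / 2"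
    then have "dist (\<epsilon>, q) (0, p) < d"
      using sqrt_sum_squares_le_sum_abs[of "dist \<epsilon> 0" "dist q p"] by (simp add: dist_Pair_Pair)
    then show "dist (G \<epsilon> q) p < e" using d(2) assms(1) by (fastforce simp: displacement_def)
  qed
qed

lemma displacement_compose:
  assumes "displacement G" "displacement H"
  shows "displacement (\<lambda>\<epsilon> q. G \<epsilon> (H \<epsilon> q))"
proof -
  have G: "continuous_on UNIV (\<lambda>z. G (fst z) (snd z))" and H: "continuous_on UNIV (\<lambda>z. H (fst z) (snd z))"
    using assms by (simp_all add: displacement_def case_prod_unfold)
  have "continuous_on UNIV (\<lambda>z. (fst z, H (fst z) (snd z)))"
    by (intro continuous_on_Pair continuous_on_fst continuous_on_id H)
  from continuous_on_compose2[OF G this]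
  have "continuous_on UNIV (\<lambda>z. G (fst z) (H (fst z) (snd z)))" by simp
  then show ?thesis using assms by (simp add: displacement_def case_prod_unfold)
qed

text \<open>The gain of the composition is the sum of the gains of the factors, both measured against the same
vector \<open>u p\<close>; the inner factor keeps points near \<open>p\<close> near \<open>p\<close>.\<close>

lemma advances_compose:
  assumes "displacement H" "weakly_advances F u G p" "weakly_advances F u H p"
  shows "weakly_advances F u (\<lambda>\<epsilon> q. G \<epsilon> (H \<epsilon> q)) p"
    and "strictly_advances F u G p \<or> strictly_advances F u H p \<Longrightarrow>
           strictly_advances F u (\<lambda>\<epsilon> q. G \<epsilon> (H \<epsilon> q)) p"
proof -
  obtain dG where dG: "dG > 0"
    "\<And>\<epsilon> q. 0 \<le> \<epsilon> \<Longrightarrow> \<epsilon> < dG \<Longrightarrow> dist q p < dG \<Longrightarrow> 0 \<le> (F (G \<epsilon> q) - F q) \<bullet> u p"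
    using assms(2) unfolding weakly_advances_def by blast
  obtain dH where dH: "dH > 0"
    "\<And>\<epsilon> q. 0 \<le> \<epsilon> \<Longrightarrow> \<epsilon> < dH \<Longrightarrow> dist q p < dH \<Longrightarrow> 0 \<le> (F (H \<epsilon> q) - F q) \<bullet> u p"
    using assms(3) unfolding weakly_advances_def by blast
  have near: "\<exists>d>0. \<forall>\<epsilon> q. 0 \<le> \<epsilon> \<and> \<epsilon> < d \<and> dist q p < d \<longrightarrow> dist (H \<epsilon> q) p < e" if "e > 0" for e
    using displacement_near[OF assms(1) that] .
  have split: "(F (G \<epsilon> (H \<epsilon> q)) - F q) \<bullet> u p =
      (F (G \<epsilon> (H \<epsilon> q)) - F (H \<epsilon> q)) \<bullet> u p + (F (H \<epsilon> q) - F q) \<bullet> u p" for \<epsilon> q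
    by (simp add: inner_diff_left)
  obtain d where d: "d > 0" "\<And>\<epsilon> q. 0 \<le> \<epsilon> \<Longrightarrow> \<epsilon> < d \<Longrightarrow> dist q p < d \<Longrightarrow> dist (H \<epsilon> q) p < dG"
    using near[OF dG(1)] by blast
  show "weakly_advances F u (\<lambda>\<epsilon> q. G \<epsilon> (H \<epsilon> q)) p"
    unfolding weakly_advances_def
  proof (intro exI conjI allI impI)
    show "min d (min dG dH) > 0" using d dG dH by simp
    fix \<epsilon> q assume "0 \<le> \<epsilon> \<and> \<epsilon> < min d (min dG dH) \<and> dist q p < min d (min dG dH)"
    then show "0 \<le> (F (G \<epsilon> (H \<epsilon> q)) - F q) \<bullet> u p"
      unfolding split using d dG dH by (intro add_nonneg_nonneg) auto
  qed
  assume "strictly_advances F u G p \<or> strictly_advances F u H p"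
  then show "strictly_advances F u (\<lambda>\<epsilon> q. G \<epsilon> (H \<epsilon> q)) p"
  proof
    assume "strictly_advances F u G p"
    then obtain d1 where d1: "d1 > 0"
      "\<And>\<epsilon> q. 0 < \<epsilon> \<Longrightarrow> \<epsilon> < d1 \<Longrightarrow> dist q p < d1 \<Longrightarrow> 0 < (F (G \<epsilon> q) - F q) \<bullet> u p"
      unfolding strictly_advances_def by blast
    obtain d2 where d2: "d2 > 0" "\<And>\<epsilon> q. 0 \<le> \<epsilon> \<Longrightarrow> \<epsilon> < d2 \<Longrightarrow> dist q p < d2 \<Longrightarrow> dist (H \<epsilon> q) p < d1"
      using near[OF d1(1)] by blast
    show ?thesis unfolding strictly_advances_def
    proof (intro exI conjI allI impI)
      show "min d2 (min d1 dH) > 0" using d1 d2 dH by simp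
      fix \<epsilon> q assume "0 < \<epsilon> \<and> \<epsilon> < min d2 (min d1 dH) \<and> dist q p < min d2 (min d1 dH)"
      then show "0 < (F (G \<epsilon> (H \<epsilon> q)) - F q) \<bullet> u p"
        unfolding split using d1 d2 dH by (intro add_pos_nonneg) auto
    qed
  next
    assume "strictly_advances F u H p"
    then obtain d1 where d1: "d1 > 0"
      "\<And>\<epsilon> q. 0 < \<epsilon> \<Longrightarrow> \<epsilon> < d1 \<Longrightarrow> dist q p < d1 \<Longrightarrow> 0 < (F (H \<epsilon> q) - F q) \<bullet> u p"
      unfolding strictly_advances_def by blast
    show ?thesis unfolding strictly_advances_def
    proof (intro exI conjI allI impI)
      show "min d (min d1 dG) > 0" using d1 d dG by simp
      fix \<epsilon> q assume "0 < \<epsilon> \<and> \<epsilon> < min d (min d1 dG) \<and> dist q p < min d (min d1 dG)"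
      then show "0 < (F (G \<epsilon> (H \<epsilon> q)) - F q) \<bullet> u p"
        unfolding split using d1 d dG by (intro add_nonneg_pos) auto
    qed
  qed
qed

text \<open>Displacements that advance strictly near single points, and go backwards nowhere, are composed over
a finite subcover.\<close>

lemma compact_strictly_advancing:
  assumes "compact K" "K \<subseteq> S"
    and loc: "\<And>p. p \<in> K \<Longrightarrow> \<exists>G N. displacement G \<and> open N \<and> p \<in> N \<and>
        (\<forall>q\<in>S. weakly_advances F u G q) \<and> (\<forall>q\<in>N. strictly_advances F u G q)"
  shows "\<exists>G. displacement G \<and> (\<forall>q\<in>K. strictly_advances F u G q)"
proof -
  have "\<forall>p\<in>K. \<exists>GN. displacement (fst GN) \<and> open (snd GN) \<and> p \<in> snd GN \<and>
        (\<forall>q\<in>S. weakly_advances F u (fst GN) q) \<and> (\<forall>q\<in>snd GN. strictly_advances F u (fst GN) q)"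
    using loc by fastforce
  from bchoice[OF this] obtain GN where GN: "\<forall>p\<in>K. displacement (fst (GN p)) \<and> open (snd (GN p)) \<and> p \<in> snd (GN p) \<and>
        (\<forall>q\<in>S. weakly_advances F u (fst (GN p)) q) \<and> (\<forall>q\<in>snd (GN p). strictly_advances F u (fst (GN p)) q)"
    by blast
  \<comment> \<open>Each point \<open>p\<close> of \<open>K\<close> carries a displacement \<open>fst (GN p)\<close> that is strict on \<open>snd (GN p)\<close>.\<close>
  obtain D where D: "D \<subseteq> K" "finite D" "K \<subseteq> (\<Union>x\<in>D. snd (GN x))"
    by (rule compactE_image[OF assms(1), of K "\<lambda>x. snd (GN x)"]) (use GN in auto)
  have "\<exists>G. displacement G \<and> (\<forall>q\<in>S. weakly_advances F u G q) \<and>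
     (\<forall>q\<in>S \<inter> (\<Union>x\<in>D. snd (GN x)). strictly_advances F u G q)"
    using D(2,1)
  proof (induction D rule: finite_induct)
    case empty
    have "displacement (\<lambda>\<epsilon> q. q)"
      by (auto simp: displacement_def case_prod_unfold intro: continuous_intros)
    moreover have "\<forall>q\<in>S. weakly_advances F u (\<lambda>\<epsilon> q. q) q"
      unfolding weakly_advances_def by (intro ballI exI[of _ 1]) simp
    ultimately show ?case by (intro exI[of _ "\<lambda>\<epsilon> q. q"]) simp
  next
    case (insert x D)
    then obtain G where G: "displacement G" "\<forall>q\<in>S. weakly_advances F u G q"
      "\<forall>q\<in>S \<inter> (\<Union>x\<in>D. snd (GN x)). strictly_advances F u G q" by blast
    have x: "displacement (fst (GN x))" "\<forall>q\<in>S. weakly_advances F u (fst (GN x)) q"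
      "\<forall>q\<in>snd (GN x). strictly_advances F u (fst (GN x)) q"
      using GN insert.prems by blast+
    show ?case
    proof (intro exI[of _ "\<lambda>\<epsilon> q. G \<epsilon> (fst (GN x) \<epsilon> q)"] conjI ballI)
      show "displacement (\<lambda>\<epsilon> q. G \<epsilon> (fst (GN x) \<epsilon> q))"
        by (rule displacement_compose[OF G(1) x(1)])
      show "weakly_advances F u (\<lambda>\<epsilon> q. G \<epsilon> (fst (GN x) \<epsilon> q)) q" if "q \<in> S" for q
        using G(2) x(2) that by (blast intro: advances_compose(1)[OF x(1)])
      show "strictly_advances F u (\<lambda>\<epsilon> q. G \<epsilon> (fst (GN x) \<epsilon> q)) q"
        if "q \<in> S \<inter> (\<Union>x\<in>insert x D. snd (GN x))" for q
      proof (rule advances_compose(2)[OF x(1)])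
        show "weakly_advances F u G q" "weakly_advances F u (fst (GN x)) q"
          using G(2) x(2) that by blast+
        show "strictly_advances F u G q \<or> strictly_advances F u (fst (GN x)) q"
          using G(3) x(3) that by blast
      qed
    qed
  qed
  then show ?thesis using D(3) assms(2) by blast
qed

text \<open>In coordinates a point is translated along a constant vector, with a bump function as factor.  A
vector on which the derivative of \<open>F\<close> has positive component along \<open>u\<close> at one point also has this
property, against all nearby values of \<open>u\<close>, at all nearby points; so by the mean value theorem the
gain is non-negative everywhere, and positive where the bump function is.\<close>

lemma chart_displacement:
  fixes \<kappa> :: "'c::euclidean_space \<Rightarrow> 'a::metric_space" and F u :: "'a \<Rightarrow> 'b::real_inner"
  assumes V: "open V" "x0 \<in> V" and W: "open W" and hom: "homeomorphism V W \<kappa> \<psi>"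
    and S: "open S" "\<kappa> x0 \<in> S" "continuous_on S u"
    and der: "\<And>x. x \<in> V \<Longrightarrow> ((\<lambda>x. F (\<kappa> x)) has_derivative D x) (at x)"
    and contD: "\<And>v. continuous_on V (\<lambda>x. D x v)"
    and pos: "D x0 w \<bullet> u (\<kappa> x0) > 0"
  shows "\<exists>G N. displacement G \<and> open N \<and> \<kappa> x0 \<in> N \<and>
        (\<forall>q\<in>S. weakly_advances F u G q) \<and> (\<forall>q\<in>N. strictly_advances F u G q)"
proof -
  have \<kappa>\<psi>: "\<And>q. q \<in> W \<Longrightarrow> \<kappa> (\<psi> q) = q" "\<And>x. x \<in> V \<Longrightarrow> \<psi> (\<kappa> x) = x" "\<kappa> ` V = W" "\<psi> ` W = V"
    "continuous_on V \<kappa>" "continuous_on W \<psi>"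
    using hom unfolding homeomorphism_def by auto
  have linD: "D x (c *\<^sub>R v) = c *\<^sub>R D x v" if "x \<in> V" for x c v
    by (rule linear_cmul[OF has_derivative_linear[OF der[OF that]]])
  have "w \<noteq> 0"
  proof
    assume "w = 0"
    then have "D x0 w = 0" using der[OF V(2)] by (metis has_derivative_linear linear_0)
    then show False using pos by simp
  qed
  define w' where "w' = sgn w"
  have w': "norm w' = 1" using \<open>w \<noteq> 0\<close> by (simp add: w'_def norm_sgn)
  have pos': "D x0 w' \<bullet> u (\<kappa> x0) > 0"
  proof -
    have "D x0 w' = inverse (norm w) *\<^sub>R D x0 w"
      using der[OF V(2)] by (simp add: w'_def sgn_div_norm linear_cmul has_derivative_linear)
    then show ?thesis using pos \<open>w \<noteq> 0\<close> by (simp add: zero_less_mult_iff)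
  qed
  obtain T where T: "open T" "T \<inter> V = \<kappa> -` S \<inter> V"
    using \<kappa>\<psi>(5) S(1) V(1) by (metis continuous_on_open_invariant)
  have xT: "x0 \<in> T \<inter> V" using T S V by auto
  let ?g = "\<lambda>(x,y). D x w' \<bullet> u (\<kappa> y)"
  have cg: "continuous_on ((T \<inter> V) \<times> (T \<inter> V)) ?g"
    unfolding case_prod_unfold
    by (intro continuous_intros continuous_on_compose2[OF contD] continuous_on_compose2[OF S(3)]
        continuous_on_compose2[OF \<kappa>\<psi>(5)]) (use T in auto)
  have "open ((T \<inter> V) \<times> (T \<inter> V))" using T V by (intro open_Times open_Int)
  then have "open {z \<in> (T \<inter> V) \<times> (T \<inter> V). ?g z > 0}"
    using continuous_open_preimage[OF cg _ open_greaterThan[of 0]]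
    by (simp add: vimage_def Int_def greaterThan_def conj_commute)
  moreover have "(x0,x0) \<in> {z \<in> (T \<inter> V) \<times> (T \<inter> V). ?g z > 0}" using xT pos' by auto
  ultimately obtain A B where "open A" "open B" "(x0,x0) \<in> A \<times> B"
    and AB5: "A \<times> B \<subseteq> {z \<in> (T \<inter> V) \<times> (T \<inter> V). ?g z > 0}"
    by (rule open_prod_elim)
  then have AB: "open A" "open B" "x0 \<in> A" "x0 \<in> B" by auto
  have "open (A \<inter> B \<inter> T \<inter> V)" "x0 \<in> A \<inter> B \<inter> T \<inter> V" using AB T V xT by auto
  then obtain \<rho> where \<rho>: "\<rho> > 0" "cball x0 \<rho> \<subseteq> A \<inter> B \<inter> T \<inter> V"
    using open_contains_cball by blast
  then have bV: "ball x0 \<rho> \<subseteq> V" and cV: "cball x0 (\<rho>/2) \<subseteq> V" by (auto simp: subset_iff)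
  have gpos: "D x w' \<bullet> u (\<kappa> y) > 0" if "x \<in> ball x0 \<rho>" "y \<in> ball x0 \<rho>" for x y
  proof -
    have "(x,y) \<in> A \<times> B" using \<rho>(2) that by (auto simp: subset_iff)
    from subsetD[OF AB5 this] show ?thesis by simp
  qed
  have img_open: "open (\<kappa> ` O')" if "open O'" "O' \<subseteq> V" for O'
    using homeomorphism_imp_open_map[OF hom, of O'] that W V
    by (simp add: openin_open_eq)
  define W0 where "W0 = \<kappa> ` ball x0 \<rho>"
  define N where "N = \<kappa> ` ball x0 (\<rho>/2)"
  define K0 where "K0 = \<kappa> ` cball x0 (\<rho>/2)"
  have W0: "open W0" unfolding W0_def using bV by (intro img_open) auto
  have N: "open N" unfolding N_def using cV by (intro img_open) (auto simp: subset_iff)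
  have NW0: "N \<subseteq> W0" unfolding N_def W0_def using \<rho>(1) by (intro image_mono) auto
  have KW0: "K0 \<subseteq> W0" unfolding K0_def W0_def using \<rho>(1) by (intro image_mono) auto
  have "compact K0"
    unfolding K0_def by (intro compact_continuous_image continuous_on_subset[OF \<kappa>\<psi>(5)] cV) simp
  then have K0: "closed K0" by (rule compact_imp_closed)
  have \<psi>W0: "\<psi> q \<in> ball x0 \<rho>" "\<kappa> (\<psi> q) = q" "\<psi> q \<in> V" if "q \<in> W0" for q
    using that \<kappa>\<psi>(2) bV by (auto simp: W0_def subset_iff)
  \<comment> \<open>The factor is at most \<open>\<rho>/2 - dist x x0\<close>, or zero where this is negative, so that the ball of
    radius \<open>\<rho>\<close> is mapped into itself; the time is clamped to make the displacement continuous for all times.\<close>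
  define c where "c = (\<lambda>\<epsilon> x. max 0 (min 1 \<epsilon>) * max 0 (\<rho>/2 - dist x x0))"
  have c0: "0 \<le> c \<epsilon> x" for \<epsilon> x by (simp add: c_def)
  have cpos: "0 < c \<epsilon> x" if "\<epsilon> > 0" "x \<in> ball x0 (\<rho>/2)" for \<epsilon> x
    using that by (simp add: c_def dist_commute)
  define k where "k = (\<lambda>\<epsilon> x. x + c \<epsilon> x *\<^sub>R w')"
  have kball: "k \<epsilon> x \<in> ball x0 \<rho>" if "x \<in> ball x0 \<rho>" for \<epsilon> x
  proof -
    have "c \<epsilon> x \<le> 1 * max 0 (\<rho>/2 - dist x x0)"
      unfolding c_def by (intro mult_right_mono) auto
    moreover have "dist (k \<epsilon> x) x0 \<le> dist x x0 + c \<epsilon> x"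
      using norm_triangle_ineq[of "x - x0" "c \<epsilon> x *\<^sub>R w'"] w' c0[of \<epsilon> x]
      by (simp add: k_def dist_norm algebra_simps)
    ultimately show ?thesis using that \<rho>(1) by (simp add: dist_commute max_def split: if_splits)
  qed
  define G where "G = (\<lambda>\<epsilon> q. if q \<in> W0 then \<kappa> (k \<epsilon> (\<psi> q)) else q)"
  have Gid: "G \<epsilon> q = q" if "q \<notin> K0" for \<epsilon> q
  proof (cases "q \<in> W0")
    case True
    then have "\<psi> q \<notin> cball x0 (\<rho>/2)" using that \<psi>W0(2)[OF True] unfolding K0_def by (metis imageI)
    then have "k \<epsilon> (\<psi> q) = \<psi> q" by (simp add: k_def c_def dist_commute max_def)
    then show ?thesis using \<psi>W0[OF True] by (simp add: G_def)
  qed (simp add: G_def)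
  have disp: "displacement G"
    unfolding displacement_def
  proof
    have 1: "continuous_on (UNIV \<times> W0) (\<lambda>(\<epsilon>, q). G \<epsilon> q)"
    proof -
      have "continuous_on (UNIV \<times> W0) (\<lambda>z. \<kappa> (k (fst z) (\<psi> (snd z))))"
        unfolding k_def c_def
        apply (rule continuous_on_compose2[OF continuous_on_subset[OF \<kappa>\<psi>(5) bV]])
         apply (intro continuous_intros continuous_on_compose2[OF \<kappa>\<psi>(6)])
        using \<psi>W0 kball \<kappa>\<psi>(3) bV unfolding k_def c_def W0_def by auto
      then show ?thesis
        by (rule continuous_on_eq) (auto simp: G_def)
    qed
    have 2: "continuous_on (UNIV \<times> (-K0)) (\<lambda>(\<epsilon>, q). G \<epsilon> q)"
      by (rule continuous_on_eq[OF continuous_on_snd[OF continuous_on_id]]) (auto simp: Gid)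
    have "continuous_on (UNIV \<times> W0 \<union> UNIV \<times> (-K0)) (\<lambda>(\<epsilon>, q). G \<epsilon> q)"
      by (intro continuous_on_open_Un 1 2 open_Times) (use W0 K0 in auto)
    moreover have "UNIV \<times> W0 \<union> UNIV \<times> (-K0) = (UNIV :: (real \<times> 'a) set)" using KW0 by auto
    ultimately show "continuous_on UNIV (\<lambda>(\<epsilon>, q). G \<epsilon> q)" by simp
    show "\<forall>q. G 0 q = q" using \<psi>W0 by (simp add: G_def k_def c_def)
  qed
  have gain: "\<exists>a>0. (F (G \<epsilon> q) - F q) \<bullet> u p = c \<epsilon> (\<psi> q) * a" if "q \<in> W0" "p \<in> W0" for \<epsilon> p q
  proof -
    define x where "x = \<psi> q"
    have x: "x \<in> ball x0 \<rho>" "\<kappa> x = q" using \<psi>W0[OF that(1)] by (auto simp: x_def)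
    define \<phi> where "\<phi> = (\<lambda>t. F (\<kappa> (x + t *\<^sub>R (c \<epsilon> x *\<^sub>R w'))) \<bullet> u p)"
    have xt: "x + t *\<^sub>R (c \<epsilon> x *\<^sub>R w') \<in> ball x0 \<rho>" if "0 \<le> t" "t \<le> 1" for t
    proof -
      have "x + t *\<^sub>R (c \<epsilon> x *\<^sub>R w') = (1 - t) *\<^sub>R x + t *\<^sub>R k \<epsilon> x"
        by (simp add: k_def algebra_simps)
      then show ?thesis using convexD_alt[OF convex_ball x(1) kball[OF x(1), of \<epsilon>] that] by simp
    qed
    have "\<exists>t::real. 0 < t \<and> t < 1 \<and> \<phi> 1 - \<phi> 0 =
        (1 - 0) * (D (x + t *\<^sub>R (c \<epsilon> x *\<^sub>R w')) (c \<epsilon> x *\<^sub>R w') \<bullet> u p)"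
    proof (rule MVT2)
      fix t :: real assume t: "0 \<le> t" "t \<le> 1"
      have "((\<lambda>t. F (\<kappa> (x + t *\<^sub>R (c \<epsilon> x *\<^sub>R w')))) has_derivative
         (\<lambda>h. D (x + t *\<^sub>R (c \<epsilon> x *\<^sub>R w')) (h *\<^sub>R (c \<epsilon> x *\<^sub>R w')))) (at t)"
        using xt[OF t] bV
        by (intro has_derivative_compose[of "\<lambda>t. x + t *\<^sub>R (c \<epsilon> x *\<^sub>R w')" _ _ _ "\<lambda>y. F (\<kappa> y)"] der)
           (auto intro!: derivative_eq_intros)
      moreover have "D (x + t *\<^sub>R (c \<epsilon> x *\<^sub>R w')) (h *\<^sub>R (c \<epsilon> x *\<^sub>R w')) =
           h *\<^sub>R D (x + t *\<^sub>R (c \<epsilon> x *\<^sub>R w')) (c \<epsilon> x *\<^sub>R w')" for h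
        by (rule linD) (use xt[OF t] bV in blast)
      ultimately have "((\<lambda>t. F (\<kappa> (x + t *\<^sub>R (c \<epsilon> x *\<^sub>R w')))) has_derivative
         (\<lambda>h. h *\<^sub>R D (x + t *\<^sub>R (c \<epsilon> x *\<^sub>R w')) (c \<epsilon> x *\<^sub>R w'))) (at t)" by simp
      then have "(\<phi> has_derivative
         (\<lambda>h. h *\<^sub>R D (x + t *\<^sub>R (c \<epsilon> x *\<^sub>R w')) (c \<epsilon> x *\<^sub>R w') \<bullet> u p)) (at t)"
        unfolding \<phi>_def by (rule has_derivative_inner_left)
      then show "(\<phi> has_real_derivative D (x + t *\<^sub>R (c \<epsilon> x *\<^sub>R w')) (c \<epsilon> x *\<^sub>R w') \<bullet> u p) (at t)"
        by (simp add: has_field_derivative_def mult_commute_abs)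
    qed simp
    then obtain t where t: "0 < t" "t < 1"
      "\<phi> 1 - \<phi> 0 = D (x + t *\<^sub>R (c \<epsilon> x *\<^sub>R w')) (c \<epsilon> x *\<^sub>R w') \<bullet> u p" by auto
    define y where "y = x + t *\<^sub>R (c \<epsilon> x *\<^sub>R w')"
    have y: "y \<in> ball x0 \<rho>" using xt t by (simp add: y_def)
    have "D y (c \<epsilon> x *\<^sub>R w') = c \<epsilon> x *\<^sub>R D y w'"
      by (rule linD) (use y bV in blast)
    then have "\<phi> 1 - \<phi> 0 = c \<epsilon> x * (D y w' \<bullet> u p)" using t(3) by (simp add: y_def)
    moreover have "\<phi> 1 - \<phi> 0 = (F (G \<epsilon> q) - F q) \<bullet> u p"
      using that x by (simp add: \<phi>_def G_def x_def k_def inner_diff_left)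
    moreover have "D y w' \<bullet> u p > 0"
      using gpos[OF y \<psi>W0(1)[OF that(2)]] \<psi>W0(2)[OF that(2)] by simp
    ultimately show ?thesis by (auto simp: x_def)
  qed
  have "weakly_advances F u G p" for p
  proof (cases "p \<in> W0")
    case True
    then obtain d where d: "d > 0" "ball p d \<subseteq> W0" using W0 open_contains_ball by blast
    have "0 \<le> (F (G \<epsilon> q) - F q) \<bullet> u p" if "dist q p < d" for \<epsilon> q
    proof -
      have "q \<in> W0" using d that by (auto simp: dist_commute)
      from gain[OF this True, of \<epsilon>] c0 show ?thesis
        by (metis mult_nonneg_nonneg order_less_imp_le)
    qed
    then show ?thesis using d unfolding weakly_advances_def by blast
  next
    case False
    then have "p \<in> - K0" using KW0 by blast
    then obtain d where d: "d > 0" "ball p d \<subseteq> - K0" using K0 open_contains_ball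
      by (metis open_Compl)
    then have "G \<epsilon> q = q" if "dist q p < d" for \<epsilon> q
      using Gid[of q \<epsilon>] that by (auto simp: dist_commute)
    then show ?thesis using d unfolding weakly_advances_def by (intro exI[of _ d]) auto
  qed
  moreover have "strictly_advances F u G p" if pN: "p \<in> N" for p
  proof -
    obtain d where d: "d > 0" "ball p d \<subseteq> N" by (rule openE[OF N pN])
    have "0 < (F (G \<epsilon> q) - F q) \<bullet> u p" if "0 < \<epsilon>" "dist q p < d" for \<epsilon> q
    proof -
      have q: "q \<in> N" using d that by (auto simp: dist_commute)
      then have "\<psi> q \<in> ball x0 (\<rho>/2)" using \<kappa>\<psi>(2) cV unfolding N_def by (auto simp: subset_iff)
      then have "0 < c \<epsilon> (\<psi> q)" using cpos that by simp
      moreover obtain a where "a > 0" "(F (G \<epsilon> q) - F q) \<bullet> u p = c \<epsilon> (\<psi> q) * a"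
        using gain[of q p \<epsilon>] q \<open>p \<in> N\<close> NW0 by blast
      ultimately show ?thesis by simp
    qed
    then show ?thesis using d unfolding strictly_advances_def by blast
  qed
  moreover have "\<kappa> x0 \<in> N" using \<rho>(1) by (simp add: N_def)
  ultimately show ?thesis using disp N by blast
qed

section \<open>Closed curves running along a vector field of the plane\<close>

text \<open>The homotopy \<open>H\<close> deforms the chords \<open>b (t + \<epsilon>) - b t\<close> into \<open>G \<epsilon> (b t) - b t\<close>.  It does not vanish,
because running forward along \<open>b\<close> for the time \<open>(1 - s) \<epsilon>\<close> and then displacing for the time
\<open>s \<epsilon>\<close> gains in the direction of \<open>u\<close>.  At the end \<open>s = 1\<close> the logarithm is pulled back from the convex
set \<open>K\<close> and is therefore periodic; since the increment over a period is locally constant in \<open>s\<close>, it is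
zero at \<open>s = 0\<close> as well, which is impossible for a simple loop.\<close>

lemma no_simple_advancing_loop:
  fixes F u :: "complex \<Rightarrow> 'b::real_inner" and b :: "real \<Rightarrow> complex"
  assumes K: "compact K" "convex K" and G: "displacement G" "\<And>q. q \<in> K \<Longrightarrow> strictly_advances F u G q"
    and T: "T > 0" and contb: "continuous_on {0..2*T} b"
    and per: "\<And>t. t \<in> {0..T} \<Longrightarrow> b (t + T) = b t" and inj: "inj_on b {0..<T}"
    and bK: "b ` {0..T} \<subseteq> K"
    and adv: "\<And>t0. t0 \<in> {0..T} \<Longrightarrow> \<exists>d>0. \<forall>t\<in>{0..T}. \<forall>\<epsilon>. \<bar>t - t0\<bar> < d \<and> 0 < \<epsilon> \<and> \<epsilon> < d \<longrightarrow>
        0 < (F (b (t + \<epsilon>)) - F (b t)) \<bullet> u (b t0)"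
  shows False
proof -
  have ne: "0 < (a - c) \<bullet> v \<Longrightarrow> a \<noteq> c" for a c v :: 'b by auto
  have "\<exists>d>0. \<forall>q\<in>K. \<forall>\<epsilon>. 0 < \<epsilon> \<and> \<epsilon> < d \<longrightarrow> G \<epsilon> q \<noteq> q"
  proof (rule compact_uniform_scale[OF K(1)])
    fix p assume "p \<in> K"
    then obtain d where d: "d > 0"
      "\<And>\<epsilon> q. 0 < \<epsilon> \<Longrightarrow> \<epsilon> < d \<Longrightarrow> dist q p < d \<Longrightarrow> 0 < (F (G \<epsilon> q) - F q) \<bullet> u p"
      using G(2) unfolding strictly_advances_def by blast
    have "G \<epsilon> q \<noteq> q" if "dist q p < d" "0 < \<epsilon>" "\<epsilon> < d" for \<epsilon> q
      using d(2)[OF that(2,3,1)] by auto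
    then show "\<exists>d>0. \<forall>q\<in>K. \<forall>\<epsilon>. dist q p < d \<and> 0 < \<epsilon> \<and> \<epsilon> < d \<longrightarrow> G \<epsilon> q \<noteq> q"
      using d(1) by blast
  qed
  then obtain dK where dK: "dK > 0" "\<And>q \<epsilon>. q \<in> K \<Longrightarrow> 0 < \<epsilon> \<Longrightarrow> \<epsilon> < dK \<Longrightarrow> G \<epsilon> q \<noteq> q" by blast
  have "\<exists>d>0. \<forall>t\<in>{0..T}. \<forall>\<epsilon>. 0 < \<epsilon> \<and> \<epsilon> < d \<longrightarrow> (\<forall>s\<in>{0..1}. G (s * \<epsilon>) (b (t + (1 - s) * \<epsilon>)) \<noteq> b t)"
  proof (rule compact_uniform_scale)
    fix t0 assume t0: "t0 \<in> {0..T}"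
    obtain d1 where d1: "d1 > 0" "\<And>t \<epsilon>. t \<in> {0..T} \<Longrightarrow> \<bar>t - t0\<bar> < d1 \<Longrightarrow> 0 < \<epsilon> \<Longrightarrow> \<epsilon> < d1 \<Longrightarrow>
        0 < (F (b (t + \<epsilon>)) - F (b t)) \<bullet> u (b t0)"
      using adv[OF t0] by blast
    have "strictly_advances F u G (b t0)" using G(2) bK t0 by blast
    then obtain d2 where d2: "d2 > 0"
      "\<And>\<epsilon> q. 0 < \<epsilon> \<Longrightarrow> \<epsilon> < d2 \<Longrightarrow> dist q (b t0) < d2 \<Longrightarrow> 0 < (F (G \<epsilon> q) - F q) \<bullet> u (b t0)"
      unfolding strictly_advances_def by blast
    have "t0 \<in> {0..2*T}" using t0 T by auto
    with contb d2(1) obtain d3 where d3: "d3 > 0" "\<And>t. t \<in> {0..2*T} \<Longrightarrow> dist t t0 < d3 \<Longrightarrow> dist (b t) (b t0) < d2"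
      unfolding continuous_on_iff by metis
    define d where "d = min (min d1 d2) (min (d3/2) T)"
    have d: "d > 0" "d \<le> d1" "d \<le> d2" "2 * d \<le> d3" "d \<le> T" using d1 d2 d3 T by (auto simp: d_def)
    have "G (s * \<epsilon>) (b (t + (1 - s) * \<epsilon>)) \<noteq> b t"
      if t: "t \<in> {0..T}" "dist t t0 < d" and e: "0 < \<epsilon>" "\<epsilon> < d" and s: "s \<in> {0..1}" for t \<epsilon> s
    proof -
      let ?q = "b (t + (1 - s) * \<epsilon>)"
      have se: "0 \<le> (1 - s) * \<epsilon>" "(1 - s) * \<epsilon> \<le> \<epsilon>" "0 \<le> s * \<epsilon>" "s * \<epsilon> \<le> \<epsilon>"
        using s e by (auto simp: mult_left_le_one_le)
      have tb: "0 \<le> t" "t \<le> T" "\<bar>t - t0\<bar> < d" using t by (auto simp: dist_real_def)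
      have "0 \<le> t + (1 - s) * \<epsilon>" "t + (1 - s) * \<epsilon> \<le> 2 * T" using tb e se d by linarith+
      then have "t + (1 - s) * \<epsilon> \<in> {0..2*T}" by simp
      moreover have "dist (t + (1 - s) * \<epsilon>) t0 < d3"
        unfolding dist_real_def using tb e se d by linarith
      ultimately have q: "dist ?q (b t0) < d2" by (rule d3(2))
      have 1: "0 < (F ?q - F (b t)) \<bullet> u (b t0)" if "s < 1"
      proof (rule d1(2)[OF t(1)])
        show "\<bar>t - t0\<bar> < d1" "(1 - s) * \<epsilon> < d1" using tb e se d by linarith+
        show "0 < (1 - s) * \<epsilon>" using e that by simp
      qed
      have 2: "0 < (F (G (s * \<epsilon>) ?q) - F ?q) \<bullet> u (b t0)" if "s > 0"
      proof (rule d2(2)[OF _ _ q])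
        show "0 < s * \<epsilon>" using e that by simp
        show "s * \<epsilon> < d2" using e se d by linarith
      qed
      have 3: "G 0 q = q" for q using G(1) by (simp add: displacement_def)
      have "0 < (F (G (s * \<epsilon>) ?q) - F (b t)) \<bullet> u (b t0)"
      proof (cases "s = 0 \<or> s = 1")
        case True
        then show ?thesis using 1 2 3 by auto
      next
        case False
        then have "s > 0" "s < 1" using s by auto
        then show ?thesis using 1 2 by (simp add: inner_diff_left)
      qed
      then show ?thesis by (auto dest!: ne)
    qed
    then show "\<exists>d>0. \<forall>t\<in>{0..T}. \<forall>\<epsilon>. dist t t0 < d \<and> 0 < \<epsilon> \<and> \<epsilon> < d \<longrightarrow>
        (\<forall>s\<in>{0..1}. G (s * \<epsilon>) (b (t + (1 - s) * \<epsilon>)) \<noteq> b t)"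
      using d(1) by blast
  qed simp
  then obtain dC where dC: "dC > 0" "\<And>t \<epsilon> s. t \<in> {0..T} \<Longrightarrow> 0 < \<epsilon> \<Longrightarrow> \<epsilon> < dC \<Longrightarrow> s \<in> {0..1} \<Longrightarrow>
      G (s * \<epsilon>) (b (t + (1 - s) * \<epsilon>)) \<noteq> b t" by blast
  define \<epsilon> where "\<epsilon> = min (min dK dC) T / 2"
  have \<epsilon>: "0 < \<epsilon>" "\<epsilon> < dK" "\<epsilon> < dC" "2 * \<epsilon> \<le> T" using dK dC T by (auto simp: \<epsilon>_def)
  have contG: "continuous_on UNIV (\<lambda>z. G (fst z) (snd z))"
    using G(1) by (simp add: displacement_def case_prod_unfold)
  have "continuous_on K (\<lambda>q. G (fst (\<epsilon>,q)) (snd (\<epsilon>,q)) - q)"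
    by (intro continuous_intros continuous_on_compose2[OF contG]) auto
  then have "continuous_on K (\<lambda>q. G \<epsilon> q - q)" by simp
  then obtain \<mu> where \<mu>: "continuous_on K \<mu>" "\<And>q. q \<in> K \<Longrightarrow> G \<epsilon> q - q = exp (\<mu> q)"
    by (rule continuous_logarithm_on_contractible[OF _ convex_imp_contractible[OF K(2)]])
       (use dK(2) \<epsilon> in auto)
  define R where "R = {0..1::real} \<times> {0..T}"
  define H where "H = (\<lambda>z. G (fst z * \<epsilon>) (b (snd z + (1 - fst z) * \<epsilon>)) - b (snd z))"
  have inner_range: "snd z + (1 - fst z) * \<epsilon> \<in> {0..2*T}" if "z \<in> R" for z
  proof -
    have "0 \<le> (1 - fst z) * \<epsilon>" "(1 - fst z) * \<epsilon> \<le> \<epsilon>"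
      using that \<epsilon> by (auto simp: R_def mult_left_le_one_le)
    moreover have "0 \<le> snd z" "snd z \<le> T" using that by (auto simp: R_def)
    ultimately have "0 \<le> snd z + (1 - fst z) * \<epsilon>" "snd z + (1 - fst z) * \<epsilon> \<le> 2 * T"
      using \<epsilon> by linarith+
    then show ?thesis by simp
  qed
  have cH: "continuous_on R H"
  proof -
    have "continuous_on R (\<lambda>z. b (snd z + (1 - fst z) * \<epsilon>))"
      by (intro continuous_on_compose2[OF contb] continuous_intros) (use inner_range in blast)
    then have "continuous_on R (\<lambda>z. (fst z * \<epsilon>, b (snd z + (1 - fst z) * \<epsilon>)))"
      by (intro continuous_intros)
    from continuous_on_compose2[OF contG this]
    have "continuous_on R (\<lambda>z. G (fst z * \<epsilon>) (b (snd z + (1 - fst z) * \<epsilon>)))" by simp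
    moreover have "continuous_on R (\<lambda>z. b (snd z))"
      by (intro continuous_on_compose2[OF contb] continuous_intros) (use T in \<open>auto simp: R_def\<close>)
    ultimately show ?thesis unfolding H_def by (intro continuous_intros)
  qed
  have "convex R" unfolding R_def by (intro convex_Times convex_real_interval)
  moreover have "H z \<noteq> 0" if "z \<in> R" for z
    using dC(2)[of "snd z" \<epsilon> "fst z"] that \<epsilon> by (auto simp: R_def H_def)
  ultimately obtain \<kappa> where \<kappa>: "continuous_on R \<kappa>" "\<And>z. z \<in> R \<Longrightarrow> H z = exp (\<kappa> z)"
    using continuous_logarithm_on_contractible[OF cH convex_imp_contractible] by blast
  have bT: "b T = b 0" using per[of 0] T by simp
  have cs: "continuous_on {0..1} (\<lambda>s. \<kappa> (s, T) - \<kappa> (s, 0))"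
    by (intro continuous_intros continuous_on_compose2[OF \<kappa>(1)]) (use T in \<open>auto simp: R_def\<close>)
  obtain n where n: "\<And>s. s \<in> {0..1} \<Longrightarrow> \<kappa> (s, T) - \<kappa> (s, 0) = of_int n * (of_real pi * \<i>)"
  proof (rule int_pi_valued_constant[OF _ _ cs, of "\<lambda>_. True"])
    fix s :: real assume s: "s \<in> {0..1}"
    have "0 \<le> (1 - s) * \<epsilon>" "(1 - s) * \<epsilon> \<le> \<epsilon>" using s \<epsilon> by (auto simp: mult_left_le_one_le)
    moreover from this have "(1 - s) * \<epsilon> \<le> T" using \<epsilon> by linarith
    ultimately have "(1 - s) * \<epsilon> \<in> {0..T}" by simp
    from per[OF this] have "b (T + (1 - s) * \<epsilon>) = b (0 + (1 - s) * \<epsilon>)"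
      by (simp add: add.commute)
    then have "H (s, T) = H (s, 0)" using bT by (simp add: H_def)
    moreover have "(s,T) \<in> R" "(s,0) \<in> R" using s T by (auto simp: R_def)
    ultimately have "exp (\<kappa> (s,T)) = exp (\<kappa> (s,0))" by (metis \<kappa>(2))
    then show "\<exists>m. True \<and> \<kappa> (s, T) - \<kappa> (s, 0) = of_int m * (of_real pi * \<i>)"
      using exp_eq_imp_diff_int_pi(1) by blast
  qed auto
  have ct: "continuous_on {0..T} (\<lambda>t. \<kappa> (1, t) - \<mu> (b t))"
    by (intro continuous_intros continuous_on_compose2[OF \<kappa>(1)] continuous_on_compose2[OF \<mu>(1)]
        continuous_on_subset[OF contb]) (use T bK in \<open>auto simp: R_def\<close>)
  obtain m where m: "\<And>t. t \<in> {0..T} \<Longrightarrow> \<kappa> (1, t) - \<mu> (b t) = of_int m * (of_real pi * \<i>)"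
  proof (rule int_pi_valued_constant[OF _ _ ct, of "\<lambda>_. True"])
    fix t assume t: "t \<in> {0..T}"
    then have "exp (\<kappa> (1,t)) = H (1,t)" using \<kappa>(2)[of "(1,t)"] by (simp add: R_def)
    also have "H (1,t) = exp (\<mu> (b t))" using \<mu>(2)[of "b t"] bK t by (auto simp: H_def image_subset_iff)
    finally show "\<exists>m. True \<and> \<kappa> (1, t) - \<mu> (b t) = of_int m * (of_real pi * \<i>)"
      using exp_eq_imp_diff_int_pi(1) by blast
  qed (use T in auto)
  have "\<kappa> (1, T) = \<kappa> (1, 0)" using m[of T] m[of 0] bT T by (simp add: diff_eq_eq)
  then have "n = 0" using n[of 1] by simp
  then have "\<kappa> (0, T) = \<kappa> (0, 0)" using n[of 0] by simp
  moreover have "\<kappa> (0, T) \<noteq> \<kappa> (0, 0)"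
  proof (rule chords_of_simple_loop_no_periodic_log[where l = "\<lambda>t. \<kappa> (0,t)", OF \<epsilon>(1,4) _ per inj])
    show "continuous_on {0..T} b" by (rule continuous_on_subset[OF contb]) (use T in auto)
    show "continuous_on {0..T} (\<lambda>t. \<kappa> (0, t))"
      by (intro continuous_intros continuous_on_compose2[OF \<kappa>(1)]) (auto simp: R_def)
    show "exp (\<kappa> (0, t)) = b (t + \<epsilon>) - b t" if "t \<in> {0..T}" for t
      using \<kappa>(2)[of "(0,t)"] that G(1) by (auto simp: R_def H_def displacement_def)
  qed auto
  ultimately show False by simp
qed

lemma periodic_int_multiple:
  fixes a :: "real \<Rightarrow> 'a"
  assumes "\<And>t. a (t + l) = a t"
  shows "a (t + of_int k * l) = a t"
proof (induction k rule: int_induct[of _ 0])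
  case (step1 i)
  then show ?case using assms[of "t + of_int i * l"] by (simp add: algebra_simps)
next
  case (step2 i)
  then show ?case using assms[of "t + of_int (i - 1) * l"] by (simp add: algebra_simps)
qed simp

lemma reduce_mod_period:
  fixes l t :: real
  assumes "l > 0"
  shows "t + of_int (- \<lfloor>t / l\<rfloor>) * l \<in> {0..l}"
proof -
  have "t + of_int (- \<lfloor>t / l\<rfloor>) * l = l * frac (t / l)" using assms by (simp add: frac_def algebra_simps)
  moreover have "l * frac (t / l) \<in> {0..l}"
    using assms frac_lt_1[of "t/l"] frac_ge_0[of "t/l"] by (auto simp: mult_left_le)
  ultimately show ?thesis by simp
qed

text \<open>Local injectivity keeps the lengths of loops away from zero, so by compactness there is a loop of
minimal length; a double point in its interior would bound a shorter one.\<close>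

lemma shortest_loop:
  fixes a :: "real \<Rightarrow> 'a::metric_space"
  assumes l: "l > 0" and per: "\<And>t. a (t + l) = a t" and cont: "continuous_on UNIV a"
    and linj: "\<And>t0. \<exists>d>0. \<forall>t \<epsilon>. dist t t0 < d \<and> 0 < \<epsilon> \<and> \<epsilon> < d \<longrightarrow> a (t + \<epsilon>) \<noteq> a t"
  obtains t1 T where "T > 0" "a (t1 + T) = a t1" "inj_on a {t1..<t1+T}"
proof -
  have perk: "a (t + of_int k * l) = a t" for t k
    by (rule periodic_int_multiple) (rule per)
  have "\<exists>d>0. \<forall>t\<in>{0..l}. \<forall>\<epsilon>. 0 < \<epsilon> \<and> \<epsilon> < d \<longrightarrow> a (t + \<epsilon>) \<noteq> a t"
    by (rule compact_uniform_scale) (use linj in \<open>simp, blast\<close>)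
  then obtain d where d: "d > 0" "\<And>t \<epsilon>. t \<in> {0..l} \<Longrightarrow> 0 < \<epsilon> \<Longrightarrow> \<epsilon> < d \<Longrightarrow> a (t + \<epsilon>) \<noteq> a t" by blast
  \<comment> \<open>Pairs of a starting time and the length of a loop; the period \<open>l\<close> occurs among the lengths.\<close>
  define Z where "Z = {z \<in> {0..l} \<times> {d..l}. a (fst z + snd z) = a (fst z)}"
  have "compact Z"
  proof -
    have "closed {z :: real \<times> real. a (fst z + snd z) = a (fst z)}"
      by (intro closed_Collect_eq continuous_on_compose2[OF cont] continuous_intros) auto
    then have "compact (({0..l} \<times> {d..l}) \<inter> {z. a (fst z + snd z) = a (fst z)})"
      by (intro compact_Int_closed compact_Times compact_Icc)
    then show ?thesis by (simp add: Z_def Int_def)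
  qed
  moreover have "(0, l) \<in> Z" using l per[of 0] d(2)[of 0 l] by (force simp: Z_def)
  ultimately obtain z where z: "z \<in> Z" "\<And>y. y \<in> Z \<Longrightarrow> snd z \<le> snd y"
    using continuous_attains_inf[of Z snd] continuous_on_snd[OF continuous_on_id] by blast
  define t1 T where "t1 = fst z" and "T = snd z"
  have T: "T > 0" "a (t1 + T) = a t1" "T \<le> l" using z(1) d(1) by (auto simp: Z_def t1_def T_def)
  have neq: "a s \<noteq> a t" if "s < t" "t - s < T" for s t
  proof
    assume eq: "a s = a t"
    define k where "k = - \<lfloor>s / l\<rfloor>"
    define s' where "s' = s + of_int k * l"
    have s': "s' \<in> {0..l}" unfolding s'_def k_def by (rule reduce_mod_period[OF l])
    have eq': "a (s' + (t - s)) = a s'"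
      using eq perk[of s k] perk[of t k] by (simp add: s'_def algebra_simps)
    then have "t - s \<ge> d" using d(2)[OF s', of "t - s"] that by force
    then have "(s', t - s) \<in> Z" using s' eq' that T by (auto simp: Z_def)
    then show False using z(2) that by (force simp: T_def)
  qed
  have "inj_on a {t1..<t1+T}"
  proof (rule inj_onI)
    fix x y assume xy: "x \<in> {t1..<t1+T}" "y \<in> {t1..<t1+T}" "a x = a y"
    show "x = y"
    proof (rule ccontr)
      assume "x \<noteq> y"
      then consider "x < y" | "y < x" by linarith
      then show False using neq[of x y] neq[of y x] xy by cases auto
    qed
  qed
  with T that show ?thesis by blast
qed

text \<open>The shortest loop of the curve may close up with a corner.  Progress is nevertheless made across it,
because it is made on both sides of the corner against the same vector \<open>u (a t1)\<close>.\<close>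

lemma no_closed_advancing_curve:
  fixes F u :: "complex \<Rightarrow> 'b::real_inner" and a :: "real \<Rightarrow> complex"
  assumes K: "compact K" "convex K" and G: "displacement G" "\<And>q. q \<in> K \<Longrightarrow> strictly_advances F u G q"
    and l: "l > 0" and per: "\<And>t. a (t + l) = a t" and cont: "continuous_on UNIV a"
    and aK: "range a \<subseteq> K"
    and adv: "\<And>t0. \<exists>d>0. \<forall>s t. s < t \<and> dist s t0 < d \<and> dist t t0 < d \<longrightarrow>
        0 < (F (a t) - F (a s)) \<bullet> u (a t0)"
  shows False
proof -
  have "\<exists>d>0. \<forall>t \<epsilon>. dist t t0 < d \<and> 0 < \<epsilon> \<and> \<epsilon> < d \<longrightarrow> a (t + \<epsilon>) \<noteq> a t" for t0
  proof -
    obtain d where d: "d > 0" "\<And>s t. s < t \<Longrightarrow> dist s t0 < d \<Longrightarrow> dist t t0 < d \<Longrightarrow> 0 < (F (a t) - F (a s)) \<bullet> u (a t0)"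
      using adv[of t0] by blast
    have "a (t + \<epsilon>) \<noteq> a t" if "dist t t0 < d/2" "0 < \<epsilon>" "\<epsilon> < d/2" for t \<epsilon>
    proof -
      have "dist (t + \<epsilon>) t0 < d" using that unfolding dist_real_def by linarith
      then have "0 < (F (a (t + \<epsilon>)) - F (a t)) \<bullet> u (a t0)" using d that by (intro d(2)) auto
      then show ?thesis by auto
    qed
    then show ?thesis using d(1) by (intro exI[of _ "d/2"]) simp
  qed
  from shortest_loop[OF l per cont this] obtain t1 T
    where T: "T > 0" "a (t1 + T) = a t1" "inj_on a {t1..<t1+T}" by blast
  \<comment> \<open>The loop is run through twice; beyond \<open>t1 + T\<close> the curve \<open>a\<close> itself need not retrace it.\<close>
  define b where "b = (\<lambda>t. if t \<le> T then a (t1 + t) else a (t1 + t - T))"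
  show False
  proof (rule no_simple_advancing_loop[OF K G T(1), of b])
    have "continuous_on ({0..T} \<union> {T..2*T}) b"
      unfolding b_def
      by (intro continuous_on_cases closed_atLeastAtMost continuous_on_compose2[OF cont] continuous_intros)
         (use T in auto)
    moreover have "{0..T} \<union> {T..2*T} = {0..2*T}" using T by auto
    ultimately show "continuous_on {0..2*T} b" by simp
    show "b (t + T) = b t" if "t \<in> {0..T}" for t
      using that T by (auto simp: b_def)
    show "inj_on b {0..<T}"
    proof (rule inj_onI)
      fix x y assume "x \<in> {0..<T}" "y \<in> {0..<T}" "b x = b y"
      then show "x = y" using inj_onD[OF T(3), of "t1 + x" "t1 + y"] by (auto simp: b_def)
    qed
    show "b ` {0..T} \<subseteq> K" using aK by (auto simp: b_def)
    fix t0 assume t0: "t0 \<in> {0..T}"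
    obtain d1 where d1: "d1 > 0" "\<And>s t. s < t \<Longrightarrow> dist s (t1 + t0) < d1 \<Longrightarrow> dist t (t1 + t0) < d1 \<Longrightarrow>
        0 < (F (a t) - F (a s)) \<bullet> u (a (t1 + t0))"
      using adv[of "t1 + t0"] by blast
    obtain d2 where d2: "d2 > 0" "\<And>s t. s < t \<Longrightarrow> dist s t1 < d2 \<Longrightarrow> dist t t1 < d2 \<Longrightarrow>
        0 < (F (a t) - F (a s)) \<bullet> u (a t1)"
      using adv[of t1] by blast
    show "\<exists>d>0. \<forall>t\<in>{0..T}. \<forall>\<epsilon>. \<bar>t - t0\<bar> < d \<and> 0 < \<epsilon> \<and> \<epsilon> < d \<longrightarrow>
        0 < (F (b (t + \<epsilon>)) - F (b t)) \<bullet> u (b t0)"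
    proof (cases "t0 = T")
      case False
      then have t0T: "t0 < T" using t0 by simp
      show ?thesis
      proof (intro exI conjI ballI allI impI)
        show "min (d1/2) ((T - t0)/2) > 0" using d1 t0T by simp
        fix t \<epsilon> assume t: "t \<in> {0..T}"
          "\<bar>t - t0\<bar> < min (d1/2) ((T - t0)/2) \<and> 0 < \<epsilon> \<and> \<epsilon> < min (d1/2) ((T - t0)/2)"
        then have "\<bar>t - t0\<bar> < d1/2" "\<epsilon> < d1/2" "0 < \<epsilon>" by auto
        note tb = this(1)[unfolded abs_less_iff] this(2,3)
        have "\<bar>t - t0\<bar> < (T - t0)/2" "\<epsilon> < (T - t0)/2" using t by auto
        from order.strict_trans1[OF abs_ge_self this(1)] this(2)
        have "t + \<epsilon> \<le> T" by (simp add: field_simps)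
        then have "b (t + \<epsilon>) = a (t1 + (t + \<epsilon>))" "b t = a (t1 + t)" "b t0 = a (t1 + t0)"
          using t t0 by (auto simp: b_def)
        moreover have "0 < (F (a (t1 + (t + \<epsilon>))) - F (a (t1 + t))) \<bullet> u (a (t1 + t0))"
        proof (rule d1(2))
          show "dist (t1 + t) (t1 + t0) < d1" "dist (t1 + (t + \<epsilon>)) (t1 + t0) < d1"
            unfolding dist_real_def abs_less_iff using tb by (auto simp: field_simps)
        qed (use tb in simp)
        ultimately show "0 < (F (b (t + \<epsilon>)) - F (b t)) \<bullet> u (b t0)" by simp
      qed
    next
      case True
      have bt0: "b t0 = a t1" "a (t1 + t0) = a t1" using True T by (auto simp: b_def)
      show ?thesis
      proof (intro exI conjI ballI allI impI)
        show "min (d1/2) d2 > 0" using d1 d2 by simp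
        fix t \<epsilon> assume t: "t \<in> {0..T}" "\<bar>t - t0\<bar> < min (d1/2) d2 \<and> 0 < \<epsilon> \<and> \<epsilon> < min (d1/2) d2"
        have bt: "b t = a (t1 + t)" using t by (simp add: b_def)
        have "\<bar>t - t0\<bar> < d1/2" "\<epsilon> < d1/2" "0 < \<epsilon>" "\<epsilon> < d2" "t \<le> T" using t by auto
        note tb = this(1)[unfolded abs_less_iff] this(2-)
        show "0 < (F (b (t + \<epsilon>)) - F (b t)) \<bullet> u (b t0)"
        proof (cases "t + \<epsilon> \<le> T")
          case True
          then have "b (t + \<epsilon>) = a (t1 + (t + \<epsilon>))" by (simp add: b_def)
          moreover have "0 < (F (a (t1 + (t + \<epsilon>))) - F (a (t1 + t))) \<bullet> u (a (t1 + t0))"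
          proof (rule d1(2))
          show "dist (t1 + t) (t1 + t0) < d1" "dist (t1 + (t + \<epsilon>)) (t1 + t0) < d1"
            unfolding dist_real_def abs_less_iff using tb by (auto simp: field_simps)
        qed (use tb in simp)
          ultimately show ?thesis using bt bt0 by simp
        next
          case False
          define \<eta> where "\<eta> = t + \<epsilon> - T"
          have \<eta>: "0 < \<eta>" "\<eta> < d2" using False tb unfolding \<eta>_def by linarith+
          have "b (t + \<epsilon>) = a (t1 + \<eta>)" using False by (simp add: b_def \<eta>_def algebra_simps)
          moreover have "0 < (F (a (t1 + \<eta>)) - F (a t1)) \<bullet> u (a t1)"
            using d2(2)[of t1 "t1 + \<eta>"] \<eta> by (simp add: dist_real_def)
          moreover have "0 \<le> (F (a t1) - F (a (t1 + t))) \<bullet> u (a t1)"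
          proof (cases "t = T")
            case True
            then show ?thesis using T by simp
          next
            case False
            then have "0 < (F (a (t1 + t0)) - F (a (t1 + t))) \<bullet> u (a (t1 + t0))"
              using d1 t \<open>t0 = T\<close> by (intro d1(2)) (auto simp: dist_real_def)
            then show ?thesis using bt0 by simp
          qed
          ultimately show ?thesis using bt bt0 by (simp add: inner_diff_left)
        qed
      qed
    qed
  qed
qed

section \<open>Continuous choice of signs on a ball\<close>

text \<open>A line field given by unit vectors \<open>g\<close> up to sign is oriented by transport along rays.  The
projection \<open>x \<mapsto> (g p \<bullet> x) g p\<close> does not depend on the sign of \<open>g p\<close> and is therefore continuous in
\<open>p\<close>.  If a ray is cut into so many pieces that consecutive lines are never orthogonal,
the successive projections of a fixed vector at the centre never vanish; the number of pieces can
be chosen uniformly, and the result is then a continuous function of the end point.\<close>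

lemma continuous_sign_choice:
  fixes g :: "'a::euclidean_space \<Rightarrow> 'b::real_inner"
  assumes unit: "\<And>p. norm (g p) = 1"
    and loc: "\<And>p. \<exists>N e. open N \<and> p \<in> N \<and> continuous_on N e \<and> (\<forall>q\<in>N. e q = g q \<or> e q = - g q)"
  shows "\<exists>u. continuous_on (cball 0 R) u \<and> (\<forall>p\<in>cball 0 R. u p = g p \<or> u p = - g p)"
proof -
  obtain N e where Ne: "\<And>p. open (N p)" "\<And>p. p \<in> N p" "\<And>p. continuous_on (N p) (e p)"
    "\<And>p q. q \<in> N p \<Longrightarrow> e p q = g q \<or> e p q = - g q"
    using loc by metis
  define C where "C = cball (0::'a) R"
  have contP: "continuous_on UNIV (\<lambda>(p, x). (g p \<bullet> x) *\<^sub>R g p)"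
  proof (intro continuous_at_imp_continuous_on ballI)
    fix z :: "'a \<times> 'b"
    obtain p x where z: "z = (p, x)" by force
    have "continuous_on (N p \<times> UNIV) (\<lambda>z. (e p (fst z) \<bullet> snd z) *\<^sub>R e p (fst z))"
      by (intro continuous_intros continuous_on_compose2[OF Ne(3)]) auto
    moreover have "(e p (fst z) \<bullet> snd z) *\<^sub>R e p (fst z) = (\<lambda>(p, x). (g p \<bullet> x) *\<^sub>R g p) z"
      if "z \<in> N p \<times> UNIV" for z
      using Ne(4)[of "fst z" p] that by auto
    ultimately have "continuous_on (N p \<times> UNIV) (\<lambda>(p, x). (g p \<bullet> x) *\<^sub>R g p)"
      by (rule continuous_on_eq)
    then show "isCont (\<lambda>(p, x). (g p \<bullet> x) *\<^sub>R g p) z"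
      using Ne(1,2) by (simp add: continuous_on_eq_continuous_at open_Times z)
  qed
  have contm: "continuous_on UNIV (\<lambda>z. (g (fst z) \<bullet> g (snd z))\<^sup>2)"
  proof (intro continuous_at_imp_continuous_on ballI)
    fix z :: "'a \<times> 'a"
    obtain p q where z: "z = (p, q)" by force
    have "continuous_on (N p \<times> N q) (\<lambda>z. (e p (fst z) \<bullet> e q (snd z))\<^sup>2)"
      by (intro continuous_intros continuous_on_compose2[OF Ne(3)]) auto
    moreover have "(e p (fst z) \<bullet> e q (snd z))\<^sup>2 = (g (fst z) \<bullet> g (snd z))\<^sup>2"
      if "z \<in> N p \<times> N q" for z
      using Ne(4)[of "fst z" p] Ne(4)[of "snd z" q] that by auto
    ultimately have "continuous_on (N p \<times> N q) (\<lambda>z. (g (fst z) \<bullet> g (snd z))\<^sup>2)"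
      by (rule continuous_on_eq)
    then show "isCont (\<lambda>z. (g (fst z) \<bullet> g (snd z))\<^sup>2) z"
      using Ne(1,2) by (simp add: continuous_on_eq_continuous_at open_Times z)
  qed
  have "uniformly_continuous_on (C \<times> C) (\<lambda>z. (g (fst z) \<bullet> g (snd z))\<^sup>2)"
    by (intro compact_uniformly_continuous continuous_on_subset[OF contm] compact_Times)
       (auto simp: C_def)
  then obtain d where d: "d > 0" "\<And>z z'. z \<in> C \<times> C \<Longrightarrow> z' \<in> C \<times> C \<Longrightarrow> dist z' z < d \<Longrightarrow>
      dist ((g (fst z') \<bullet> g (snd z'))\<^sup>2) ((g (fst z) \<bullet> g (snd z))\<^sup>2) < 1"
    unfolding uniformly_continuous_on_def by (metis zero_less_one)
  \<comment> \<open>The bound \<open>1\<close> on the variation suffices because the function is \<open>1\<close> on the diagonal.\<close>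
  have nonorth: "g q \<bullet> g p \<noteq> 0" if "p \<in> C" "q \<in> C" "dist q p < d" for p q
  proof
    assume "g q \<bullet> g p = 0"
    moreover have "dist (q, p) (p, p) < d" using that by (simp add: dist_Pair_Pair)
    ultimately show False using d(2)[of "(p,p)" "(q,p)"] that unit[of p] by (simp add: dot_square_norm)
  qed
  obtain n where n: "\<bar>R\<bar> / d < real (Suc n)"
    using reals_Archimedean2 by (metis lessI less_trans of_nat_less_iff)
  \<comment> \<open>The \<open>k\<close>-th division point on the ray to \<open>p\<close>.\<close>
  define q where "q = (\<lambda>k p. (real k / real (Suc n)) *\<^sub>R (p::'a))"
  have qC: "q k p \<in> C" if "p \<in> C" "k \<le> Suc n" for k p
  proof -
    have "norm (q k p) \<le> 1 * norm p"
      unfolding q_def norm_scaleR using that by (intro mult_right_mono) auto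
    then show ?thesis using that by (simp add: C_def)
  qed
  have qd: "dist (q (Suc k) p) (q k p) < d" if "p \<in> C" for k p
  proof -
    have "q (Suc k) p - q k p = (1 / real (Suc n)) *\<^sub>R p"
      by (simp add: q_def flip: scaleR_diff_left diff_divide_distrib)
    then have "dist (q (Suc k) p) (q k p) = norm p / real (Suc n)" by (simp add: dist_norm)
    also have "\<dots> \<le> \<bar>R\<bar> / real (Suc n)" using that by (intro divide_right_mono) (auto simp: C_def)
    also have "\<dots> < d" using n d(1) by (simp add: field_simps del: of_nat_Suc)
    finally show ?thesis .
  qed
  have "\<exists>u. continuous_on C u \<and> (\<forall>p\<in>C. \<exists>c. c \<noteq> 0 \<and> u p = c *\<^sub>R g (q k p))" if "k \<le> Suc n" for k
    using that
  proof (induction k)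
    case 0
    have "\<forall>p\<in>C. \<exists>c. c \<noteq> 0 \<and> g 0 = c *\<^sub>R g (q 0 p)"
      by (intro ballI exI[of _ 1]) (simp add: q_def)
    then show ?case by (intro exI[of _ "\<lambda>_. g 0"]) simp
  next
    case (Suc k)
    then obtain u where u: "continuous_on C u" "\<And>p. p \<in> C \<Longrightarrow> \<exists>c. c \<noteq> 0 \<and> u p = c *\<^sub>R g (q k p)" by auto
    let ?u = "\<lambda>p. (g (q (Suc k) p) \<bullet> u p) *\<^sub>R g (q (Suc k) p)"
    have "continuous_on C (\<lambda>p. (q (Suc k) p, u p))"
      unfolding q_def by (intro continuous_intros u(1))
    from continuous_on_compose2[OF contP this] have "continuous_on C ?u" by simp
    moreover have "\<exists>c. c \<noteq> 0 \<and> ?u p = c *\<^sub>R g (q (Suc k) p)" if p: "p \<in> C" for p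
    proof (intro exI conjI)
      obtain c where c: "c \<noteq> 0" "u p = c *\<^sub>R g (q k p)" using u(2)[OF p] by blast
      have "g (q (Suc k) p) \<bullet> g (q k p) \<noteq> 0"
        using Suc.prems p by (intro nonorth qC qd) auto
      then show "g (q (Suc k) p) \<bullet> u p \<noteq> 0" using c by simp
    qed simp
    ultimately show ?case by blast
  qed
  from this[of "Suc n"] obtain u where u: "continuous_on C u"
    "\<And>p. p \<in> C \<Longrightarrow> \<exists>c. c \<noteq> 0 \<and> u p = c *\<^sub>R g p"
    by (auto simp: q_def simp del: of_nat_Suc)
  have sgn: "sgn (u p) = g p \<or> sgn (u p) = - g p" if p: "p \<in> C" for p
  proof -
    obtain c where c: "c \<noteq> 0" "u p = c *\<^sub>R g p" using u(2)[OF p] by blast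
    have "sgn (g p) = g p" using unit[of p] by (simp add: sgn_div_norm)
    then show ?thesis using c by (cases "c > 0") (auto simp: sgn_scaleR)
  qed
  moreover have "continuous_on C (\<lambda>p. sgn (u p))"
  proof (rule continuous_on_sgn[OF u(1)])
    show "\<forall>p\<in>C. u p \<noteq> 0" using u(2) unit by (metis norm_zero scale_eq_0_iff zero_neq_one)
  qed
  ultimately show ?thesis unfolding C_def by (intro exI[of _ "\<lambda>p. sgn (u p)"]) simp
qed

section \<open>Calculus of the second fundamental form\<close>

text \<open>The left-hand side is symmetric in \<open>v\<close> and \<open>w\<close>; this is the classical route to the symmetry of the
second derivative.\<close>

lemma second_difference_mean_value:
  fixes g :: "'a::real_normed_vector \<Rightarrow> real"
  assumes h: "h > 0" and S: "\<And>s t. 0 \<le> s \<Longrightarrow> s \<le> h \<Longrightarrow> 0 \<le> t \<Longrightarrow> t \<le> h \<Longrightarrow> x + s *\<^sub>R v + t *\<^sub>R w \<in> S"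
    and d1: "\<And>y. y \<in> S \<Longrightarrow> (g has_derivative g' y) (at y)"
    and d2: "\<And>y. y \<in> S \<Longrightarrow> ((\<lambda>y. g' y v) has_derivative g'' y) (at y)"
  shows "\<exists>s t. 0 < s \<and> s < h \<and> 0 < t \<and> t < h \<and>
    g (x + h *\<^sub>R v + h *\<^sub>R w) - g (x + h *\<^sub>R v) - (g (x + h *\<^sub>R w) - g x) =
      h * h * g'' (x + s *\<^sub>R v + t *\<^sub>R w) w"
proof -
  define \<phi> where "\<phi> = (\<lambda>s. g (x + s *\<^sub>R v + h *\<^sub>R w) - g (x + s *\<^sub>R v))"
  have line: "((\<lambda>s. G (z + s *\<^sub>R e)) has_real_derivative G' e) (at s)"
    if "(G has_derivative G') (at (z + s *\<^sub>R e))" for G :: "'a \<Rightarrow> real" and G' z e s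
  proof -
    have "((\<lambda>s. z + s *\<^sub>R e) has_derivative (\<lambda>k. k *\<^sub>R e)) (at s)"
      by (auto intro!: derivative_eq_intros)
    from has_derivative_compose[OF this that]
    have "((\<lambda>s. G (z + s *\<^sub>R e)) has_derivative (\<lambda>k. G' (k *\<^sub>R e))) (at s)" .
    moreover have "G' (k *\<^sub>R e) = k * G' e" for k
      using linear_cmul[OF has_derivative_linear[OF that]] by simp
    ultimately show ?thesis by (simp add: has_field_derivative_def mult_commute_abs)
  qed
  have "\<exists>s::real. 0 < s \<and> s < h \<and> \<phi> h - \<phi> 0 =
      (h - 0) * (g' (x + s *\<^sub>R v + h *\<^sub>R w) v - g' (x + s *\<^sub>R v) v)"
  proof (rule MVT2[OF h])
    fix s assume s: "0 \<le> s" "s \<le> h"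
    have "x + h *\<^sub>R w + s *\<^sub>R v \<in> S" "x + s *\<^sub>R v \<in> S"
      using S[of s h] S[of s 0] s h by (auto simp: algebra_simps)
    from DERIV_diff[OF line[OF d1[OF this(1)]] line[OF d1[OF this(2)]]]
    show "(\<phi> has_real_derivative g' (x + s *\<^sub>R v + h *\<^sub>R w) v - g' (x + s *\<^sub>R v) v) (at s)"
      by (simp add: \<phi>_def algebra_simps)
  qed
  then obtain s where s: "0 < s" "s < h" "\<phi> h - \<phi> 0 = h * (g' (x + s *\<^sub>R v + h *\<^sub>R w) v - g' (x + s *\<^sub>R v) v)"
    by auto
  have "\<exists>t::real. 0 < t \<and> t < h \<and> g' (x + s *\<^sub>R v + h *\<^sub>R w) v - g' (x + s *\<^sub>R v + 0 *\<^sub>R w) v =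
      (h - 0) * g'' (x + s *\<^sub>R v + t *\<^sub>R w) w"
  proof (rule MVT2[OF h])
    fix t assume "0 \<le> t" "t \<le> h"
    then show "((\<lambda>t. g' (x + s *\<^sub>R v + t *\<^sub>R w) v) has_real_derivative g'' (x + s *\<^sub>R v + t *\<^sub>R w) w) (at t)"
      by (intro line d2 S) (use s in auto)
  qed
  then obtain t where t: "0 < t" "t < h" "g' (x + s *\<^sub>R v + h *\<^sub>R w) v - g' (x + s *\<^sub>R v) v =
      h * g'' (x + s *\<^sub>R v + t *\<^sub>R w) w" by auto
  show ?thesis using s t by (intro exI[of _ s] exI[of _ t]) (simp add: \<phi>_def)
qed

lemma second_derivative_symmetric_real:
  fixes g :: "'a::real_normed_vector \<Rightarrow> real"
  assumes S: "open S" "x \<in> S"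
    and d1: "\<And>y. y \<in> S \<Longrightarrow> (g has_derivative g' y) (at y)"
    and d2: "\<And>y u. y \<in> S \<Longrightarrow> ((\<lambda>y. g' y u) has_derivative g'' u y) (at y)"
    and cont: "\<And>u z. continuous_on S (\<lambda>y. g'' u y z)"
  shows "g'' v x w = g'' w x v"
proof (rule ccontr)
  assume neq: "g'' v x w \<noteq> g'' w x v"
  define e where "e = \<bar>g'' v x w - g'' w x v\<bar> / 2"
  have e: "e > 0" using neq by (simp add: e_def)
  have "isCont (\<lambda>y. g'' v y w) x" "isCont (\<lambda>y. g'' w y v) x"
    using cont S by (auto simp: continuous_on_eq_continuous_at)
  then obtain d1 d2 where d: "d1 > 0" "d2 > 0"
    "\<And>y. dist y x < d1 \<Longrightarrow> dist (g'' v y w) (g'' v x w) < e"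
    "\<And>y. dist y x < d2 \<Longrightarrow> dist (g'' w y v) (g'' w x v) < e"
    using e unfolding continuous_at_eps_delta by blast
  obtain d3 where d3: "d3 > 0" "ball x d3 \<subseteq> S" by (rule openE[OF S])
  define \<rho> where "\<rho> = min (min d1 d2) d3"
  have \<rho>: "\<rho> > 0" using d d3 by (simp add: \<rho>_def)
  \<comment> \<open>With this \<open>h\<close> the parallelogram lies in the ball of radius \<open>\<rho>\<close> around \<open>x\<close>.\<close>
  define h where "h = \<rho> / (2 * (norm v + norm w + 1))"
  have nn: "norm v + norm w + 1 > 0" by (simp add: add_nonneg_pos)
  have h: "h > 0" using \<rho> nn by (simp add: h_def)
  have hr: "h * (norm v + norm w) < \<rho>"
  proof -
    have "h * (norm v + norm w) \<le> h * (norm v + norm w + 1)" using h by simp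
    also have "\<dots> = \<rho> / 2" using nn unfolding h_def by (simp add: field_simps)
    also have "\<dots> < \<rho>" using \<rho> by simp
    finally show ?thesis .
  qed
  have near: "dist (x + s *\<^sub>R a + t *\<^sub>R b) x < \<rho>"
    if "0 \<le> s" "s \<le> h" "0 \<le> t" "t \<le> h" "norm a + norm b = norm v + norm w" for s t a b
  proof -
    have "dist (x + s *\<^sub>R a + t *\<^sub>R b) x \<le> s * norm a + t * norm b"
      using norm_triangle_ineq[of "s *\<^sub>R a" "t *\<^sub>R b"] that by (simp add: dist_norm algebra_simps)
    also have "\<dots> \<le> h * norm a + h * norm b" using that by (intro add_mono mult_right_mono) auto
    also have "\<dots> = h * (norm v + norm w)" using that by (simp add: distrib_left flip: that(5))
    finally show ?thesis using hr by simp
  qed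
  have inS: "x + s *\<^sub>R a + t *\<^sub>R b \<in> S"
    if "0 \<le> s" "s \<le> h" "0 \<le> t" "t \<le> h" "norm a + norm b = norm v + norm w" for s t a b
    using near[OF that] d3 by (auto simp: \<rho>_def dist_commute)
  let ?\<Delta> = "g (x + h *\<^sub>R v + h *\<^sub>R w) - g (x + h *\<^sub>R v) - (g (x + h *\<^sub>R w) - g x)"
  obtain s t where st: "0 < s" "s < h" "0 < t" "t < h" "?\<Delta> = h * h * g'' v (x + s *\<^sub>R v + t *\<^sub>R w) w"
    using second_difference_mean_value[OF h inS[of _ _ v w] d1 d2] by auto
  have "\<exists>s t. 0 < s \<and> s < h \<and> 0 < t \<and> t < h \<and>
    g (x + h *\<^sub>R w + h *\<^sub>R v) - g (x + h *\<^sub>R w) - (g (x + h *\<^sub>R v) - g x) =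
      h * h * g'' w (x + s *\<^sub>R w + t *\<^sub>R v) v"
    by (rule second_difference_mean_value[OF h inS[of _ _ w v] d1 d2]) auto
  then obtain s' t' where st': "0 < s'" "s' < h" "0 < t'" "t' < h"
    "?\<Delta> = h * h * g'' w (x + s' *\<^sub>R w + t' *\<^sub>R v) v"
    by (auto simp: algebra_simps)
  have "g'' v (x + s *\<^sub>R v + t *\<^sub>R w) w = g'' w (x + s' *\<^sub>R w + t' *\<^sub>R v) v"
    using st(5) st'(5) h by simp
  moreover have "dist (g'' v (x + s *\<^sub>R v + t *\<^sub>R w) w) (g'' v x w) < e"
    using near[of s t v w] st by (intro d(3)) (auto simp: \<rho>_def)
  moreover have "dist (g'' w (x + s' *\<^sub>R w + t' *\<^sub>R v) v) (g'' w x v) < e"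
    using near[of s' t' w v] st' by (intro d(4)) (auto simp: \<rho>_def)
  ultimately show False unfolding e_def dist_real_def by (simp add: abs_if split: if_splits)
qed

abbreviation D :: "('a::real_normed_vector \<Rightarrow> 'b::real_normed_vector) \<Rightarrow> 'a \<Rightarrow> 'a \<Rightarrow> 'b" where
  "D f x \<equiv> frechet_derivative f (at x)"

lemma smooth_on_has_derivative:
  assumes "smooth_on f S" "x \<in> S"
  shows "(f has_derivative D f x) (at x)"
    and "((\<lambda>y. D f y v) has_derivative D (\<lambda>y. D f y v) x) (at x)"
proof -
  have "Ck_on (Suc (Suc 0)) f S" using assms by (simp only: smooth_on_def)
  then show "(f has_derivative D f x) (at x)" "((\<lambda>y. D f y v) has_derivative D (\<lambda>y. D f y v) x) (at x)"
    using assms(2) by (auto simp: frechet_derivative_works)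
qed

lemma smooth_on_continuous:
  assumes "smooth_on f S"
  shows "continuous_on S f" "continuous_on S (\<lambda>x. D f x v)"
    "continuous_on S (\<lambda>x. D (\<lambda>y. D f y v) x w)"
proof -
  have "Ck_on 0 f S" "Ck_on (Suc 0) f S" "Ck_on (Suc (Suc 0)) f S"
    using assms by (simp_all only: smooth_on_def)
  then show "continuous_on S f" "continuous_on S (\<lambda>x. D f x v)"
    "continuous_on S (\<lambda>x. D (\<lambda>y. D f y v) x w)"
    by auto
qed

lemma smooth_on_linear:
  assumes "smooth_on f S" "x \<in> S"
  shows "linear (D f x)" "linear (D (\<lambda>y. D f y v) x)"
  using smooth_on_has_derivative[OF assms] by (auto intro: has_derivative_linear)

lemma smooth_on_second_derivative_symmetric:
  fixes f :: "'a::real_normed_vector \<Rightarrow> 'b::real_inner"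
  assumes f: "smooth_on f S" and x: "x \<in> S"
  shows "D (\<lambda>y. D f y v) x w \<bullet> n = D (\<lambda>y. D f y w) x v \<bullet> n"
proof (rule second_derivative_symmetric_real[where g = "\<lambda>y. f y \<bullet> n" and g' = "\<lambda>y v. D f y v \<bullet> n"
      and g'' = "\<lambda>v y w. D (\<lambda>y. D f y v) y w \<bullet> n"])
  show "open S" using f by (simp add: smooth_on_def)
  show "((\<lambda>y. f y \<bullet> n) has_derivative (\<lambda>v. D f y v \<bullet> n)) (at y)" if "y \<in> S" for y
    by (intro has_derivative_inner_left smooth_on_has_derivative[OF f that])
  show "((\<lambda>y. D f y u \<bullet> n) has_derivative (\<lambda>w. D (\<lambda>y. D f y u) y w \<bullet> n)) (at y)" if "y \<in> S" for y u
    by (intro has_derivative_inner_left smooth_on_has_derivative[OF f that])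
  show "continuous_on S (\<lambda>y. D (\<lambda>y. D f y u) y z \<bullet> n)" for u z
    by (intro continuous_intros smooth_on_continuous[OF f])
qed (fact x)

lemma vec2_expand: "v = v $ 1 *\<^sub>R axis 1 1 + v $ 2 *\<^sub>R axis 2 (1::real)" for v :: "real^2"
  by (simp add: vec_eq_iff forall_2 axis_def)

lemma linear_vec2:
  assumes "linear (g :: real^2 \<Rightarrow> 'b::real_vector)"
  shows "g v = v $ 1 *\<^sub>R g (axis 1 1) + v $ 2 *\<^sub>R g (axis 2 1)"
  by (subst vec2_expand[of v]) (simp add: linear_add[OF assms] linear_cmul[OF assms])

text \<open>The signed area of the parallelogram spanned by two vectors.\<close>

definition wedge :: "real^2 \<Rightarrow> real^2 \<Rightarrow> real" where
  "wedge v w = v $ 1 * w $ 2 - v $ 2 * w $ 1"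

lemma wedge_linear_image:
  assumes "linear (g :: real^2 \<Rightarrow> real^2)"
  shows "wedge (g v) (g w) = wedge (g (axis 1 1)) (g (axis 2 1)) * wedge v w"
  by (subst linear_vec2[OF assms, of v], subst linear_vec2[OF assms, of w])
     (simp add: wedge_def algebra_simps)

lemma wedge_eq_0_imp_parallel:
  assumes "wedge v w = 0" "v \<noteq> 0" "w \<noteq> 0"
  shows "\<exists>k. k \<noteq> 0 \<and> w = k *\<^sub>R v"
proof (cases "v $ 1 = 0")
  case True
  then have v2: "v $ 2 \<noteq> 0" using assms(2) by (auto simp: vec_eq_iff forall_2)
  then have "w = (w $ 2 / v $ 2) *\<^sub>R v" using assms(1) True by (simp add: vec_eq_iff forall_2 wedge_def)
  then show ?thesis using assms(3) by (metis scale_zero_left)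
next
  case False
  then have "w = (w $ 1 / v $ 1) *\<^sub>R v"
    using assms(1) by (simp add: vec_eq_iff forall_2 wedge_def field_simps)
  then show ?thesis using assms(3) by (metis scale_zero_left)
qed

lemma second_form_symmetric:
  assumes "smooth_on r S" "x \<in> S"
  shows "second_form r x v w = second_form r x w v"
  unfolding second_form_def by (rule smooth_on_second_derivative_symmetric[OF assms])

lemma second_form_linear:
  assumes "smooth_on r S" "x \<in> S"
  shows "linear (\<lambda>w. second_form r x v w)" "linear (\<lambda>v. second_form r x v w)"
proof -
  have l: "linear (\<lambda>w. second_form r x v w)" for v
    unfolding second_form_def
    using linear_compose[OF smooth_on_linear(2)[OF assms] bounded_linear.linear[OF bounded_linear_inner_left]]
    by (simp add: o_def)
  show "linear (\<lambda>w. second_form r x v w)" by (rule l)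
  show "linear (\<lambda>v. second_form r x v w)"
    using l[of w] by (simp add: second_form_symmetric[OF assms, of _ w])
qed

lemma second_form_expand:
  assumes "smooth_on r S" "x \<in> S"
  shows "second_form r x v w = second_form r x (axis 1 1) (axis 1 1) * (v $ 1 * w $ 1)
     + second_form r x (axis 1 1) (axis 2 1) * (v $ 1 * w $ 2 + v $ 2 * w $ 1)
     + second_form r x (axis 2 1) (axis 2 1) * (v $ 2 * w $ 2)"
proof -
  note l = second_form_linear[OF assms]
  show ?thesis
    by (subst linear_vec2[OF l(1)], subst (1 2) linear_vec2[OF l(2)])
       (simp add: second_form_symmetric[OF assms, of "axis 2 1" "axis 1 1"] algebra_simps)
qed

lemma cross_derivative_nonzero:
  assumes "linear (g :: real^2 \<Rightarrow> real^3)" "inj g"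
  shows "cross3 (g (axis 1 1)) (g (axis 2 1)) \<noteq> 0"
proof
  assume "cross3 (g (axis 1 1)) (g (axis 2 1)) = 0"
  then have "collinear {0, g (axis 1 1), g (axis 2 1)}" by (simp add: cross_eq_0)
  moreover have "g (axis 1 1) \<noteq> 0" "g (axis 2 1) \<noteq> 0"
    using assms by (metis linear_injective_0 axis_eq_0_iff zero_neq_one)+
  ultimately obtain c where "g (axis 2 1) = c *\<^sub>R g (axis 1 1)"
    by (auto simp: collinear_lemma)
  then have "g (axis 2 1) = g (c *\<^sub>R axis 1 1)" by (simp add: linear_cmul[OF assms(1)])
  then have "axis 2 1 = c *\<^sub>R (axis 1 1 :: real^2)" using assms(2) by (rule injD[rotated])
  then have "(axis 2 1 :: real^2) $ 2 = (c *\<^sub>R (axis 1 1 :: real^2)) $ 2" by simp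
  then show False by (simp add: axis_def)
qed

lemma second_form_continuous:
  assumes "smooth_on r S" "\<And>x. x \<in> S \<Longrightarrow> inj (D r x)"
  shows "continuous_on S (\<lambda>x. second_form r x v w)"
proof -
  have nz: "cross3 (D r x (axis 1 1)) (D r x (axis 2 1)) \<noteq> 0" if "x \<in> S" for x
    using cross_derivative_nonzero smooth_on_linear(1)[OF assms(1) that] assms(2)[OF that] by blast
  have "continuous_on S (\<lambda>x. cross3 (D r x (axis 1 1)) (D r x (axis 2 1)))"
    by (intro continuous_on_cross smooth_on_continuous[OF assms(1)])
  then have "continuous_on S (\<lambda>x. unit_normal r x)"
    unfolding unit_normal_def by (intro continuous_on_sgn) (use nz in auto)
  then show ?thesis unfolding second_form_def
    by (intro continuous_intros smooth_on_continuous[OF assms(1)])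
qed

text \<open>The determinant of the first fundamental form is non-negative by the Cauchy-Schwarz inequality, so a
negative quotient means that the second fundamental form has negative determinant.\<close>

lemma negative_curvature_discriminant:
  assumes "smooth_on r S" "x \<in> S" "gauss_curvature r x < 0"
  shows "second_form r x (axis 1 1) (axis 1 1) * second_form r x (axis 2 1) (axis 2 1)
     < (second_form r x (axis 1 1) (axis 2 1))\<^sup>2"
proof -
  have "det (form_matrix (first_form r x)) \<ge> 0"
    using Cauchy_Schwarz_ineq[of "D r x (axis 1 1)" "D r x (axis 2 1)"]
    by (simp add: det_2 form_matrix_def first_form_def power2_eq_square inner_commute)
  then have "det (form_matrix (second_form r x)) < 0"
    using assms(3) by (simp add: gauss_curvature_def divide_less_0_iff)
  then show ?thesis
    by (simp add: det_2 form_matrix_def power2_eq_square second_form_symmetric[OF assms(1,2), of "axis 2 1" "axis 1 1"])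
qed

section \<open>The two types of asymptotic vectors\<close>

text \<open>Only the sign of \<open>c\<close> matters: \<open>s\<close> is meant to be \<open>1\<close> or \<open>-1\<close>.  The condition at \<open>w = v\<close> says
that \<open>v\<close> is asymptotic.\<close>

definition asym_type :: "real \<Rightarrow> (real^2 \<Rightarrow> real^3) \<Rightarrow> real^2 \<Rightarrow> real^2 \<Rightarrow> bool" where
  "asym_type s r x v \<longleftrightarrow> v \<noteq> 0 \<and> (\<exists>c. s * c > 0 \<and> (\<forall>w. second_form r x v w = c * wedge v w))"

text \<open>By symmetry of the second fundamental form, two vectors with constants \<open>c\<close> and \<open>d\<close> satisfy
\<open>(c + d) wedge v w = 0\<close>, and constants of the same sign do not cancel.\<close>

lemma asym_type_parallel:
  assumes r: "smooth_on r S" "x \<in> S" and "asym_type s r x v" "asym_type s r x w"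
  shows "\<exists>k. k \<noteq> 0 \<and> w = k *\<^sub>R v"
proof -
  obtain c where c: "v \<noteq> 0" "s * c > 0" "\<And>u. second_form r x v u = c * wedge v u"
    using assms(3) unfolding asym_type_def by blast
  obtain d where d: "w \<noteq> 0" "s * d > 0" "\<And>u. second_form r x w u = d * wedge w u"
    using assms(4) unfolding asym_type_def by blast
  have "c * wedge v w = d * wedge w v"
    using c(3)[of w] d(3)[of v] second_form_symmetric[OF r, of v w] by simp
  moreover have "wedge w v = - wedge v w" by (simp add: wedge_def)
  ultimately have "c * wedge v w + d * wedge v w = 0" by simp
  then have "(s * c + s * d) * wedge v w = 0"
    by (metis distrib_left distrib_right mult.assoc mult_zero_right)
  moreover have "s * c + s * d > 0" using c(2) d(2) by (rule add_pos_pos)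
  ultimately have "wedge v w = 0" by simp
  then show ?thesis using c(1) d(1) by (rule wedge_eq_0_imp_parallel)
qed

lemma asym_type_unique_sign:
  assumes "asym_type 1 r x v"
  shows "\<not> asym_type (-1) r x v"
proof
  assume "asym_type (-1) r x v"
  then obtain c d where v: "v \<noteq> 0" and c: "c > 0" "\<And>u. second_form r x v u = c * wedge v u"
    and d: "d < 0" "\<And>u. second_form r x v u = d * wedge v u"
    using assms unfolding asym_type_def by fastforce
  \<comment> \<open>The rotated vector spans a positive area with \<open>v\<close>, so it determines the constant.\<close>
  define u where "u = (vector [- v $ 2, v $ 1] :: real^2)"
  have "wedge v u = v $ 1 * v $ 1 + v $ 2 * v $ 2" by (simp add: wedge_def u_def)
  also have "\<dots> \<noteq> 0" using v by (simp add: vec_eq_iff forall_2 sum_squares_eq_zero_iff)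
  finally have "c = d" using c(2)[of u] d(2)[of u] by simp
  then show False using c d by simp
qed

lemma asym_type_scale:
  assumes r: "smooth_on r S" "x \<in> S" and "asym_type s r x v" "k \<noteq> 0"
  shows "asym_type s r x (k *\<^sub>R v)"
proof -
  obtain c where c: "v \<noteq> 0" "s * c > 0" "\<And>u. second_form r x v u = c * wedge v u"
    using assms(3) unfolding asym_type_def by blast
  have "second_form r x (k *\<^sub>R v) u = c * wedge (k *\<^sub>R v) u" for u
    using linear_cmul[OF second_form_linear(2)[OF r, of u], of k v] c(3)[of u]
    by (simp add: wedge_def algebra_simps)
  then show ?thesis using c assms(4) unfolding asym_type_def by auto
qed

text \<open>The linear form \<open>II(v, \<cdot>)\<close> is represented by \<open>(p, q)\<close>.  It vanishes on \<open>v\<close>, hence is a multiple of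
\<open>wedge v\<close>; the factor is not zero because the second fundamental form is nondegenerate.\<close>

lemma asymptotic_vector_has_type:
  assumes r: "smooth_on r S" "x \<in> S" and K: "gauss_curvature r x < 0"
    and v: "v \<noteq> 0" "second_form r x v v = 0"
  shows "asym_type 1 r x v \<or> asym_type (-1) r x v"
proof -
  let ?L = "second_form r x (axis 1 1) (axis 1 1)"
  let ?M = "second_form r x (axis 1 1) (axis 2 1)"
  let ?N = "second_form r x (axis 2 1) (axis 2 1)"
  define p q where "p = ?L * v $ 1 + ?M * v $ 2" and "q = ?M * v $ 1 + ?N * v $ 2"
  have sf: "second_form r x v w = p * w $ 1 + q * w $ 2" for w
    by (subst second_form_expand[OF r]) (simp add: p_def q_def algebra_simps)
  have vv: "v $ 1 * v $ 1 + v $ 2 * v $ 2 > 0"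
    using v(1) by (simp add: vec_eq_iff forall_2 sum_squares_gt_zero_iff)
  have pq: "p * v $ 1 = - q * v $ 2" using v(2) sf[of v] by simp
  define W where "W = v $ 1 * v $ 1 + v $ 2 * v $ 2"
  define c where "c = (q * v $ 1 - p * v $ 2) / W"
  have W: "W > 0" using vv by (simp add: W_def)
  have cW: "c * W = q * v $ 1 - p * v $ 2" using W by (simp add: c_def)
  have "W * (p + c * v $ 2) = 0" "W * (q - c * v $ 1) = 0"
    using cW pq W_def by algebra+
  then have p: "p = - c * v $ 2" and q: "q = c * v $ 1" using W by auto
  have sfc: "second_form r x v w = c * wedge v w" for w
    by (simp add: sf p q wedge_def algebra_simps)
  have "c \<noteq> 0"
  proof
    assume "c = 0"
    then have e: "?L * v $ 1 + ?M * v $ 2 = 0" "?M * v $ 1 + ?N * v $ 2 = 0"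
      using p q by (simp_all add: p_def q_def)
    have "?L * ?N - ?M\<^sup>2 < 0" using negative_curvature_discriminant[OF r K] by simp
    moreover have "(?L * ?N - ?M\<^sup>2) * v $ 1 = 0" "(?L * ?N - ?M\<^sup>2) * v $ 2 = 0"
      using e by algebra+
    ultimately have "v $ 1 = 0" "v $ 2 = 0" by (metis less_irrefl mult_eq_0_iff)+
    then show False using v(1) by (simp add: vec_eq_iff forall_2)
  qed
  then consider "1 * c > 0" | "(- 1) * c > 0" by fastforce
  then show ?thesis
  proof cases
    case 1
    then have "asym_type 1 r x v" using v(1) sfc unfolding asym_type_def by blast
    then show ?thesis ..
  next
    case 2
    then have "asym_type (-1) r x v" using v(1) sfc unfolding asym_type_def by blast
    then show ?thesis ..
  qed
qed

text \<open>With the coefficients \<open>L\<close>, \<open>M\<close>, \<open>N\<close> of the second fundamental form and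
\<open>d = s sqrt (M\<^sup>2 - L N)\<close>, the vectors of type \<open>s\<close> are the kernel of a matrix of rank one, with rows
\<open>(M - d, N)\<close> and \<open>(L, M + d)\<close>.  Either row gives a continuous solution, and at a given point at
least one of the two solutions is not zero.\<close>

lemma local_asymptotic_field:
  assumes r: "smooth_on r S" "x0 \<in> S" and inj: "\<And>x. x \<in> S \<Longrightarrow> inj (D r x)"
    and K: "\<And>x. x \<in> S \<Longrightarrow> gauss_curvature r x < 0" and s: "s = 1 \<or> s = -1"
  shows "\<exists>B v. open B \<and> x0 \<in> B \<and> B \<subseteq> S \<and> continuous_on B v \<and> (\<forall>x\<in>B. asym_type s r x (v x))"
proof -
  have S: "open S" using r by (simp add: smooth_on_def)
  define L where "L = (\<lambda>x. second_form r x (axis 1 1) (axis 1 1))"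
  define M where "M = (\<lambda>x. second_form r x (axis 1 1) (axis 2 1))"
  define N where "N = (\<lambda>x. second_form r x (axis 2 1) (axis 2 1))"
  have cont: "continuous_on S L" "continuous_on S M" "continuous_on S N"
    unfolding L_def M_def N_def by (intro second_form_continuous[OF r(1) inj]; assumption)+
  define d where "d = (\<lambda>x. s * sqrt ((M x)\<^sup>2 - L x * N x))"
  have contd: "continuous_on S d" unfolding d_def by (intro continuous_intros cont)
  have sd: "s * d x > 0" and dd: "d x * d x = (M x)\<^sup>2 - L x * N x" if "x \<in> S" for x
  proof -
    have *: "(M x)\<^sup>2 - L x * N x > 0"
      using negative_curvature_discriminant[OF r(1) that K[OF that]] by (simp add: L_def M_def N_def)
    then show "s * d x > 0" using s by (auto simp: d_def)
    show "d x * d x = (M x)\<^sup>2 - L x * N x" using * s by (auto simp: d_def)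
  qed
  have type: "asym_type s r x v"
    if x: "x \<in> S" and v: "v \<noteq> 0" "(M x - d x) * v $ 1 + N x * v $ 2 = 0" "L x * v $ 1 + (M x + d x) * v $ 2 = 0" for x v
  proof -
    have "second_form r x v w = d x * wedge v w" for w
    proof -
      have "second_form r x v w = (L x * v $ 1 + M x * v $ 2) * w $ 1 + (M x * v $ 1 + N x * v $ 2) * w $ 2"
        by (subst second_form_expand[OF r(1) x]) (simp add: L_def M_def N_def algebra_simps)
      also have "L x * v $ 1 + M x * v $ 2 = - d x * v $ 2" using v(3) by (simp add: algebra_simps)
      also have "M x * v $ 1 + N x * v $ 2 = d x * v $ 1" using v(2) by (simp add: algebra_simps)
      finally show ?thesis by (simp add: wedge_def algebra_simps)
    qed
    then show ?thesis using v(1) sd[OF x] unfolding asym_type_def by auto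
  qed
  define v1 where "v1 = (\<lambda>x. - (M x + d x) *\<^sub>R axis 1 1 + L x *\<^sub>R axis 2 1 :: real^2)"
  define v2 where "v2 = (\<lambda>x. N x *\<^sub>R axis 1 1 + (d x - M x) *\<^sub>R axis 2 1 :: real^2)"
  have comp: "v1 x $ 1 = - (M x + d x)" "v1 x $ 2 = L x" "v2 x $ 1 = N x" "v2 x $ 2 = d x - M x" for x
    by (simp_all add: v1_def v2_def axis_def)
  have cv: "continuous_on S v1" "continuous_on S v2"
    unfolding v1_def v2_def by (intro continuous_intros cont contd)+
  have t1: "asym_type s r x (v1 x)" if "x \<in> S" "v1 x \<noteq> 0" for x
    using dd[OF that(1)] by (intro type that) (simp_all add: comp algebra_simps power2_eq_square)
  have t2: "asym_type s r x (v2 x)" if "x \<in> S" "v2 x \<noteq> 0" for x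
    using dd[OF that(1)] by (intro type that) (simp_all add: comp algebra_simps power2_eq_square)
  have "v1 x0 \<noteq> 0 \<or> v2 x0 \<noteq> 0"
  proof (rule ccontr)
    assume "\<not> ?thesis"
    then have "- (M x0 + d x0) = 0" "d x0 - M x0 = 0" using comp[of x0] by simp_all
    then show False using sd[OF r(2)] by simp
  qed
  moreover have *: "\<exists>B v. open B \<and> x0 \<in> B \<and> B \<subseteq> S \<and> continuous_on B v \<and> (\<forall>x\<in>B. asym_type s r x (v x))"
    if c: "continuous_on S v" and t: "\<And>x. x \<in> S \<Longrightarrow> v x \<noteq> 0 \<Longrightarrow> asym_type s r x (v x)" and nz: "v x0 \<noteq> 0" for v
  proof (intro exI[of _ "S \<inter> v -` (- {0})"] exI[of _ v] conjI ballI)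
    show "open (S \<inter> v -` (- {0}))" by (rule continuous_open_preimage[OF c S open_Compl[OF closed_singleton]])
    show "continuous_on (S \<inter> v -` (- {0})) v" using c by (rule continuous_on_subset) blast
  qed (use r(2) t nz in auto)
  ultimately show ?thesis using *[OF cv(1) t1] *[OF cv(2) t2] by blast
qed

text \<open>Write \<open>\<Phi>\<close> for the derivative of the coordinate change and \<open>\<delta>\<close> for its determinant.  Differentiating
\<open>r' = r \<circ> \<tau>\<close> twice yields a term with the second derivative of \<open>\<tau>\<close>, but that term is tangential,
and the normals differ by the sign of \<open>\<delta>\<close>.  So \<open>II'(v, w) = sgn \<delta> II(\<Phi> v, \<Phi> w)\<close>, and as \<open>wedge\<close>
is multiplied by \<open>\<delta>\<close>, the constant \<open>c\<close> is divided by \<open>\<bar>\<delta>\<bar>\<close>: its sign is preserved.\<close>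

lemma asym_type_chart_change:
  fixes r r' :: "real^2 \<Rightarrow> real^3" and \<tau> :: "real^2 \<Rightarrow> real^2"
  assumes r: "smooth_on r S" and \<tau>: "smooth_on \<tau> V" and y: "y \<in> V" and sub: "\<tau> ` V \<subseteq> S"
    and eq: "\<And>z. z \<in> V \<Longrightarrow> r' z = r (\<tau> z)"
    and inj': "inj (D r' y)"
  shows "D r' y v = D r (\<tau> y) (D \<tau> y v)"
    and "asym_type s r' y v \<Longrightarrow> asym_type s r (\<tau> y) (D \<tau> y v)"
proof -
  have V: "open V" using \<tau> by (simp add: smooth_on_def)
  let ?x = "\<tau> y" and ?\<Phi> = "D \<tau> y"
  have xS: "\<tau> z \<in> S" if "z \<in> V" for z using sub that by auto
  have der': "(r' has_derivative (\<lambda>v. D r (\<tau> z) (D \<tau> z v))) (at z)" if z: "z \<in> V" for z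
    by (rule has_derivative_transform_within_open[OF has_derivative_compose[OF
          smooth_on_has_derivative(1)[OF \<tau> z] smooth_on_has_derivative(1)[OF r xS[OF z]]] V z])
       (simp add: eq)
  have D': "D r' z v = D r (\<tau> z) (D \<tau> z v)" if "z \<in> V" for z v
    by (subst frechet_derivative_at[OF der'[OF that], symmetric]) simp
  show "D r' y v = D r (\<tau> y) (D \<tau> y v)" by (rule D'[OF y])
  note lin\<Phi> = smooth_on_linear(1)[OF \<tau> y] and linr = smooth_on_linear(1)[OF r xS]
  let ?e1 = "axis 1 1 :: real^2" and ?e2 = "axis 2 1 :: real^2"
  define \<delta> where "\<delta> = wedge (?\<Phi> ?e1) (?\<Phi> ?e2)"
  have inj\<Phi>: "inj ?\<Phi>"
  proof (rule injI)
    fix a b assume "?\<Phi> a = ?\<Phi> b"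
    then have "D r' y a = D r' y b" by (simp add: D'[OF y])
    then show "a = b" using inj' by (simp add: inj_eq)
  qed
  have surj\<Phi>: "\<exists>w'. w = ?\<Phi> w'" for w
    using linear_injective_imp_surjective[OF lin\<Phi> inj\<Phi>] by (metis surjD)
  have normal: "unit_normal r' y = sgn \<delta> *\<^sub>R unit_normal r ?x"
  proof -
    have "cross3 (D r' y ?e1) (D r' y ?e2) = \<delta> *\<^sub>R cross3 (D r ?x ?e1) (D r ?x ?e2)"
      unfolding D'[OF y] \<delta>_def wedge_def
      by (subst linear_vec2[OF linr[OF y], of "?\<Phi> ?e1"], subst linear_vec2[OF linr[OF y], of "?\<Phi> ?e2"])
         (simp add: cross_add_left cross_add_right cross_mult_left cross_mult_right
           cross_skew[of "D r ?x ?e2" "D r ?x ?e1"] algebra_simps)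
    then show ?thesis by (simp add: unit_normal_def sgn_scaleR)
  qed
  have orth: "D r ?x w \<bullet> unit_normal r ?x = 0" for w
    by (subst linear_vec2[OF linr[OF y]])
       (simp add: unit_normal_def sgn_div_norm inner_add_left dot_cross_self)
  have second: "D (\<lambda>z. D r' z v) y w \<bullet> unit_normal r ?x = second_form r ?x (?\<Phi> v) (?\<Phi> w)" for v w
  proof -
    let ?T = "\<lambda>z. D \<tau> z v"
    have dT: "((\<lambda>z. ?T z $ i) has_derivative (\<lambda>w. D ?T y w $ i)) (at y)" for i
      by (rule bounded_linear.has_derivative[OF bounded_linear_vec_nth smooth_on_has_derivative(2)[OF \<tau> y]])
    have dR: "((\<lambda>z. D r (\<tau> z) e) has_derivative (\<lambda>w. D (\<lambda>u. D r u e) ?x (?\<Phi> w))) (at y)" for e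
      by (rule has_derivative_compose[OF smooth_on_has_derivative(1)[OF \<tau> y]
          smooth_on_has_derivative(2)[OF r xS[OF y]]])
    have "((\<lambda>z. ?T z $ 1 *\<^sub>R D r (\<tau> z) ?e1 + ?T z $ 2 *\<^sub>R D r (\<tau> z) ?e2) has_derivative
       (\<lambda>w. (?T y $ 1 *\<^sub>R D (\<lambda>u. D r u ?e1) ?x (?\<Phi> w) + D ?T y w $ 1 *\<^sub>R D r ?x ?e1)
          + (?T y $ 2 *\<^sub>R D (\<lambda>u. D r u ?e2) ?x (?\<Phi> w) + D ?T y w $ 2 *\<^sub>R D r ?x ?e2))) (at y)"
      by (intro has_derivative_add has_derivative_scaleR dT dR)
    then have "((\<lambda>z. D r' z v) has_derivative
       (\<lambda>w. (?T y $ 1 *\<^sub>R D (\<lambda>u. D r u ?e1) ?x (?\<Phi> w) + D ?T y w $ 1 *\<^sub>R D r ?x ?e1)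
          + (?T y $ 2 *\<^sub>R D (\<lambda>u. D r u ?e2) ?x (?\<Phi> w) + D ?T y w $ 2 *\<^sub>R D r ?x ?e2))) (at y)"
    proof (rule has_derivative_transform_within_open[OF _ V y])
      fix z assume z: "z \<in> V"
      show "?T z $ 1 *\<^sub>R D r (\<tau> z) ?e1 + ?T z $ 2 *\<^sub>R D r (\<tau> z) ?e2 = D r' z v"
        unfolding D'[OF z] by (rule linear_vec2[OF linr[OF z], symmetric])
    qed
    from frechet_derivative_at[OF this, symmetric]
    have "D (\<lambda>z. D r' z v) y w \<bullet> unit_normal r ?x =
       ?\<Phi> v $ 1 * second_form r ?x ?e1 (?\<Phi> w) + ?\<Phi> v $ 2 * second_form r ?x ?e2 (?\<Phi> w)"
      by (simp add: inner_add_left orth second_form_def)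
    also have "\<dots> = second_form r ?x (?\<Phi> v) (?\<Phi> w)"
      by (subst linear_vec2[OF second_form_linear(2)[OF r xS[OF y]], of "?\<Phi> v"]) simp
    finally show ?thesis .
  qed
  have sf: "second_form r' y v w = sgn \<delta> * second_form r ?x (?\<Phi> v) (?\<Phi> w)" for v w
    by (simp add: second_form_def[of r'] normal second)
  assume "asym_type s r' y v"
  then obtain c where c: "v \<noteq> 0" "s * c > 0" "\<And>u. second_form r' y v u = c * wedge v u"
    unfolding asym_type_def by blast
  have "\<delta> \<noteq> 0"
  proof
    assume "\<delta> = 0"
    then have w0: "wedge v u = 0" for u using sf[of v u] c(3)[of u] c(2) by auto
    have "v $ 1 = 0" "v $ 2 = 0" using w0[of ?e2] w0[of ?e1] by (simp_all add: wedge_def axis_def)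
    then show False using c(1) by (simp add: vec_eq_iff forall_2)
  qed
  have "second_form r ?x (?\<Phi> v) w = (c / \<bar>\<delta>\<bar>) * wedge (?\<Phi> v) w" for w
  proof -
    obtain u where u: "w = ?\<Phi> u" using surj\<Phi> by blast
    have "sgn \<delta> * second_form r ?x (?\<Phi> v) w = c * wedge v u" using sf c(3) u by metis
    moreover have "wedge (?\<Phi> v) w = \<delta> * wedge v u"
      unfolding u \<delta>_def by (rule wedge_linear_image[OF lin\<Phi>])
    ultimately show ?thesis using \<open>\<delta> \<noteq> 0\<close> by (simp add: sgn_if abs_if split: if_splits)
  qed
  moreover have "s * (c / \<bar>\<delta>\<bar>) > 0" using c(2) \<open>\<delta> \<noteq> 0\<close> by simp
  moreover have "?\<Phi> v \<noteq> 0" using c(1) inj\<Phi> lin\<Phi> by (metis linear_injective_0)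
  ultimately show "asym_type s r ?x (?\<Phi> v)" unfolding asym_type_def by blast
qed

section \<open>Asymptotic directions on a negatively curved surface\<close>

locale negative_surface =
  fixes X :: "'a topology" and A :: "'a chart set" and f :: "'a \<Rightarrow> real^3"
  assumes regular: "regular_surface X A f"
    and negative: "\<forall>(U, \<phi>)\<in>A. \<forall>p\<in>U. gauss_curvature (local_param f (U, \<phi>)) (\<phi> p) < 0"
begin

lemma chart:
  assumes "(U, \<phi>) \<in> A"
  shows "openin X U" "open (\<phi> ` U)" "inj_on \<phi> U"
    and "homeomorphic_maps (subtopology X U) (top_of_set (\<phi> ` U)) \<phi> (inv_into U \<phi>)"
    and "smooth_on (local_param f (U, \<phi>)) (\<phi> ` U)"
    and "\<And>x. x \<in> \<phi> ` U \<Longrightarrow> inj (D (local_param f (U, \<phi>)) x)"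
    and "\<And>x. x \<in> \<phi> ` U \<Longrightarrow> gauss_curvature (local_param f (U, \<phi>)) x < 0"
proof -
  have "is_chart X (U, \<phi>)" using regular assms
    by (simp add: regular_surface_def smooth_surface_def)
  then have c: "openin X U" "open (\<phi> ` U)" "homeomorphic_map (subtopology X U) (top_of_set (\<phi> ` U)) \<phi>"
    by (auto simp: is_chart_def)
  then show "openin X U" "open (\<phi> ` U)" by auto
  have U: "topspace (subtopology X U) = U" using openin_subset[OF c(1)] by auto
  show inj: "inj_on \<phi> U" using c(3) U by (simp add: homeomorphic_map_def)
  obtain g where g: "homeomorphic_maps (subtopology X U) (top_of_set (\<phi> ` U)) \<phi> g"
    using c(3) by (auto simp: homeomorphic_map_maps)
  have "inv_into U \<phi> y = g y" if y: "y \<in> \<phi> ` U" for y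
  proof -
    obtain p where p: "p \<in> U" "y = \<phi> p" using y by blast
    have "g (\<phi> p) = p" using g p(1) U unfolding homeomorphic_maps_def by metis
    then show ?thesis using p inj by simp
  qed
  then show "homeomorphic_maps (subtopology X U) (top_of_set (\<phi> ` U)) \<phi> (inv_into U \<phi>)"
    using homeomorphic_maps_eq[OF g, of \<phi> "inv_into U \<phi>"] by auto
  show "smooth_on (local_param f (U, \<phi>)) (\<phi> ` U)"
    and "\<And>x. x \<in> \<phi> ` U \<Longrightarrow> inj (D (local_param f (U, \<phi>)) x)"
    using bspec[OF regular[unfolded regular_surface_def smooth_immersion_def, THEN conjunct2] assms]
    by auto
  show "\<And>x. x \<in> \<phi> ` U \<Longrightarrow> gauss_curvature (local_param f (U, \<phi>)) x < 0"
    using bspec[OF negative assms] by auto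
qed

lemma chart_covers:
  assumes "p \<in> topspace X"
  obtains U \<phi> where "(U, \<phi>) \<in> A" "p \<in> U"
proof -
  have "topspace X = (\<Union>(U, \<phi>)\<in>A. U)" using regular by (simp add: regular_surface_def smooth_surface_def)
  with assms that show ?thesis by fastforce
qed

lemma local_param_chart [simp]:
  assumes "(U, \<phi>) \<in> A" "p \<in> U"
  shows "local_param f (U, \<phi>) (\<phi> p) = f p"
  using chart(3)[OF assms(1)] assms(2) by (simp add: local_param_def)

text \<open>Vectors of type \<open>s\<close> are regarded as vectors in space, by means of some chart.  The choice of the chart
does not matter, which is the content of \<open>asym_dir_in_chart\<close> below.\<close>

definition asym_dir :: "real \<Rightarrow> 'a \<Rightarrow> real^3 \<Rightarrow> bool" where
  "asym_dir s p e \<longleftrightarrow> (\<exists>U \<phi> v. (U, \<phi>) \<in> A \<and> p \<in> U \<and>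
     asym_type s (local_param f (U, \<phi>)) (\<phi> p) v \<and> e = D (local_param f (U, \<phi>)) (\<phi> p) v)"

lemma asym_dirI:
  assumes "(U, \<phi>) \<in> A" "p \<in> U" "asym_type s (local_param f (U, \<phi>)) (\<phi> p) v"
  shows "asym_dir s p (D (local_param f (U, \<phi>)) (\<phi> p) v)"
  using assms unfolding asym_dir_def by blast

lemma asym_dir_in_chart:
  assumes "asym_dir s p e" "(U, \<phi>) \<in> A" "p \<in> U"
  obtains v where "asym_type s (local_param f (U, \<phi>)) (\<phi> p) v" "e = D (local_param f (U, \<phi>)) (\<phi> p) v"
proof -
  obtain V \<psi> v where V: "(V, \<psi>) \<in> A" "p \<in> V" and v: "asym_type s (local_param f (V, \<psi>)) (\<psi> p) v"
    "e = D (local_param f (V, \<psi>)) (\<psi> p) v"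
    using assms(1) unfolding asym_dir_def by blast
  define \<tau> where "\<tau> = \<phi> \<circ> inv_into V \<psi>"
  have \<tau>\<psi>: "\<tau> (\<psi> q) = \<phi> q" if "q \<in> V" for q
    using chart(3)[OF V(1)] that by (simp add: \<tau>_def)
  have sm: "smooth_on \<tau> (\<psi> ` (V \<inter> U))"
  proof -
    have "\<forall>(U, \<phi>)\<in>A. \<forall>(V, \<psi>)\<in>A. smooth_on (\<psi> \<circ> inv_into U \<phi>) (\<phi> ` (U \<inter> V))"
      using regular unfolding regular_surface_def smooth_surface_def by (elim conjE)
    from bspec[OF this V(1)] have "\<forall>(U, \<phi>)\<in>A. smooth_on (\<phi> \<circ> inv_into V \<psi>) (\<psi> ` (V \<inter> U))" by simp
    from bspec[OF this assms(2)] show ?thesis by (simp add: \<tau>_def)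
  qed
  have p: "\<psi> p \<in> \<psi> ` (V \<inter> U)" using V assms(3) by blast
  have sub: "\<tau> ` \<psi> ` (V \<inter> U) \<subseteq> \<phi> ` U" using \<tau>\<psi> by auto
  have eq: "local_param f (V, \<psi>) z = local_param f (U, \<phi>) (\<tau> z)" if z: "z \<in> \<psi> ` (V \<inter> U)" for z
    using z V(1) assms(2) by (auto simp: \<tau>\<psi>)
  have inj: "inj (D (local_param f (V, \<psi>)) (\<psi> p))" using chart(6)[OF V(1)] V(2) by blast
  note change = asym_type_chart_change[OF chart(5)[OF assms(2)] sm p sub eq inj]
  show ?thesis
    using that[of "D \<tau> (\<psi> p) v"] change(1)[of v] change(2)[OF _ v(1)] v(2) \<tau>\<psi>[OF V(2)] by simp
qed

lemma asym_dir_nonzero: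
  assumes "asym_dir s p e"
  shows "e \<noteq> 0"
proof -
  obtain U \<phi> v where c: "(U, \<phi>) \<in> A" "p \<in> U" and v: "asym_type s (local_param f (U, \<phi>)) (\<phi> p) v"
    "e = D (local_param f (U, \<phi>)) (\<phi> p) v"
    using assms unfolding asym_dir_def by blast
  have "\<phi> p \<in> \<phi> ` U" using c by blast
  then show ?thesis
    using v chart(6)[OF c(1)] smooth_on_linear(1)[OF chart(5)[OF c(1)]]
    by (metis linear_injective_0 asym_type_def)
qed

lemma asym_dir_scale:
  assumes "asym_dir s p e" "k \<noteq> 0"
  shows "asym_dir s p (k *\<^sub>R e)"
proof -
  obtain U \<phi> v where c: "(U, \<phi>) \<in> A" "p \<in> U" and v: "asym_type s (local_param f (U, \<phi>)) (\<phi> p) v"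
    "e = D (local_param f (U, \<phi>)) (\<phi> p) v"
    using assms unfolding asym_dir_def by blast
  have x: "\<phi> p \<in> \<phi> ` U" using c by blast
  have "k *\<^sub>R e = D (local_param f (U, \<phi>)) (\<phi> p) (k *\<^sub>R v)"
    using linear_cmul[OF smooth_on_linear(1)[OF chart(5)[OF c(1)] x]] v(2) by simp
  then show ?thesis
    using asym_type_scale[OF chart(5)[OF c(1)] x v(1) assms(2)] c unfolding asym_dir_def by blast
qed

lemma asym_dir_parallel:
  assumes "asym_dir s p e" "asym_dir s p e'"
  shows "\<exists>k. k \<noteq> 0 \<and> e' = k *\<^sub>R e"
proof -
  obtain U \<phi> v where c: "(U, \<phi>) \<in> A" "p \<in> U" and v: "asym_type s (local_param f (U, \<phi>)) (\<phi> p) v"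
    "e = D (local_param f (U, \<phi>)) (\<phi> p) v"
    using assms(1) unfolding asym_dir_def by blast
  obtain v' where v': "asym_type s (local_param f (U, \<phi>)) (\<phi> p) v'"
    "e' = D (local_param f (U, \<phi>)) (\<phi> p) v'" by (rule asym_dir_in_chart[OF assms(2) c])
  have x: "\<phi> p \<in> \<phi> ` U" using c by blast
  obtain k where "k \<noteq> 0" "v' = k *\<^sub>R v"
    using asym_type_parallel[OF chart(5)[OF c(1)] x v(1) v'(1)] by blast
  then show ?thesis using v(2) v'(2) linear_cmul[OF smooth_on_linear(1)[OF chart(5)[OF c(1)] x]] by auto
qed

lemma asym_dir_unique_sign:
  assumes "asym_dir 1 p e"
  shows "\<not> asym_dir (-1) p e"
proof
  assume m: "asym_dir (-1) p e"
  obtain U \<phi> v where c: "(U, \<phi>) \<in> A" "p \<in> U" and v: "asym_type 1 (local_param f (U, \<phi>)) (\<phi> p) v"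
    "e = D (local_param f (U, \<phi>)) (\<phi> p) v"
    using assms(1) unfolding asym_dir_def by blast
  obtain v' where v': "asym_type (-1) (local_param f (U, \<phi>)) (\<phi> p) v'"
    "e = D (local_param f (U, \<phi>)) (\<phi> p) v'" by (rule asym_dir_in_chart[OF m c])
  have "inj (D (local_param f (U, \<phi>)) (\<phi> p))" using chart(6)[OF c(1)] c(2) by blast
  then have "v = v'" using v(2) v'(2) by (simp add: inj_eq)
  then show False using asym_type_unique_sign v(1) v'(1) by blast
qed

lemma asym_dir_local_field:
  assumes c: "(U, \<phi>) \<in> A" "p \<in> U" and s: "s = 1 \<or> s = -1"
  shows "\<exists>B e. open B \<and> \<phi> p \<in> B \<and> B \<subseteq> \<phi> ` U \<and> continuous_on B e \<and>
    (\<forall>x\<in>B. asym_dir s (inv_into U \<phi> x) (e x))"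
proof -
  let ?r = "local_param f (U, \<phi>)"
  have x: "\<phi> p \<in> \<phi> ` U" using c by blast
  note r = chart(5)[OF c(1)]
  obtain B v where B: "open B" "\<phi> p \<in> B" "B \<subseteq> \<phi> ` U" "continuous_on B v"
    "\<And>x. x \<in> B \<Longrightarrow> asym_type s ?r x (v x)"
    using local_asymptotic_field[OF r x chart(6)[OF c(1)] chart(7)[OF c(1)] s] by blast
  have "continuous_on B (\<lambda>x. v x $ 1 *\<^sub>R D ?r x (axis 1 1) + v x $ 2 *\<^sub>R D ?r x (axis 2 1))"
    by (intro continuous_intros B(4) continuous_on_subset[OF smooth_on_continuous(2)[OF r] B(3)])
  moreover have "v x $ 1 *\<^sub>R D ?r x (axis 1 1) + v x $ 2 *\<^sub>R D ?r x (axis 2 1) = D ?r x (v x)"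
    if "x \<in> B" for x
    by (rule linear_vec2[symmetric, OF smooth_on_linear(1)[OF r]]) (use that B(3) in blast)
  ultimately have "continuous_on B (\<lambda>x. D ?r x (v x))" by (simp cong: continuous_on_cong)
  moreover have "asym_dir s (inv_into U \<phi> x) (D ?r x (v x))" if xB: "x \<in> B" for x
  proof -
    obtain q where q: "q \<in> U" "x = \<phi> q" using xB B(3) by blast
    then have "inv_into U \<phi> x = q" using chart(3)[OF c(1)] by simp
    moreover have "asym_type s ?r (\<phi> q) (v x)" using B(5)[OF xB] q(2) by simp
    ultimately show ?thesis using asym_dirI[OF c(1) q(1)] q(2) by simp
  qed
  ultimately show ?thesis using B by blast
qed

lemma asym_dir_exists:
  assumes "p \<in> topspace X" "s = 1 \<or> s = -1"
  shows "\<exists>e. asym_dir s p e"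
proof -
  obtain U \<phi> where c: "(U, \<phi>) \<in> A" "p \<in> U" by (rule chart_covers[OF assms(1)])
  obtain B e where B: "\<phi> p \<in> B" "\<forall>x\<in>B. asym_dir s (inv_into U \<phi> x) (e x)"
    using asym_dir_local_field[OF c assms(2)] by blast
  have "inv_into U \<phi> (\<phi> p) = p" using chart(3)[OF c(1)] c(2) by simp
  then show ?thesis using B by metis
qed

lemma asymptotic_curve_velocity:
  assumes \<alpha>: "asymptotic_curve X A f UNIV \<alpha>"
  obtains E where "\<And>t. ((\<lambda>t. f (\<alpha> t)) has_vector_derivative E t) (at t)"
    and "continuous_on UNIV E"
    and "\<And>t. asym_dir 1 (\<alpha> t) (E t) \<or> asym_dir (-1) (\<alpha> t) (E t)"
proof -
  define E where "E = (\<lambda>t. vector_derivative (\<lambda>t. f (\<alpha> t)) (at t))"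
  have c\<alpha>: "continuous_map euclidean X \<alpha>"
    using \<alpha> by (simp add: asymptotic_curve_def regular_curve_def)
  have local: "((\<lambda>t. f (\<alpha> t)) has_vector_derivative E t) (at t) \<and> isCont E t \<and>
      (asym_dir 1 (\<alpha> t) (E t) \<or> asym_dir (-1) (\<alpha> t) (E t))" for t
  proof -
    have "\<alpha> t \<in> topspace X" using c\<alpha> by (auto simp: continuous_map_def)
    then obtain U \<phi> where c: "(U, \<phi>) \<in> A" "\<alpha> t \<in> U" by (rule chart_covers)
    let ?r = "local_param f (U, \<phi>)"
    note r = chart(5)[OF c(1)]
    define J where "J = {t. \<alpha> t \<in> U}"
    have J: "open J" using openin_continuous_map_preimage[OF c\<alpha> chart(1)[OF c(1)]] by (simp add: J_def)
    have tJ: "t \<in> J" using c by (simp add: J_def)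
    define v where "v = (\<lambda>t. D (\<phi> \<circ> \<alpha>) t 1)"
    have sm: "smooth_on (\<phi> \<circ> \<alpha>) J"
      using \<alpha> c(1) unfolding asymptotic_curve_def regular_curve_def J_def by fastforce
    have dv: "((\<phi> \<circ> \<alpha>) has_vector_derivative v t) (at t)" if "t \<in> J" for t
    proof -
      have "D (\<phi> \<circ> \<alpha>) t (h *\<^sub>R 1) = h *\<^sub>R v t" for h
        unfolding v_def by (rule linear_cmul[OF smooth_on_linear(1)[OF sm that]])
      then have "D (\<phi> \<circ> \<alpha>) t = (\<lambda>h. h *\<^sub>R v t)" by (simp add: fun_eq_iff)
      then show ?thesis
        using smooth_on_has_derivative(1)[OF sm that] by (simp add: has_vector_derivative_def)
    qed
    have vd: "vector_derivative (\<phi> \<circ> \<alpha>) (at t) = v t" if "t \<in> J" for t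
      using dv[OF that] by (rule vector_derivative_at)
    have cv: "continuous_on J v" unfolding v_def by (rule smooth_on_continuous(2)[OF sm])
    have xU: "\<phi> (\<alpha> t) \<in> \<phi> ` U" if "t \<in> J" for t using that by (simp add: J_def)
    have dE: "((\<lambda>t. f (\<alpha> t)) has_vector_derivative D ?r (\<phi> (\<alpha> t)) (v t)) (at t)" if t: "t \<in> J" for t
    proof -
      have "((\<lambda>t. ?r ((\<phi> \<circ> \<alpha>) t)) has_derivative (\<lambda>h. D ?r ((\<phi> \<circ> \<alpha>) t) (h *\<^sub>R v t))) (at t)"
        using has_derivative_compose[OF dv[OF t, unfolded has_vector_derivative_def]]
          smooth_on_has_derivative(1)[OF r xU[OF t]] by simp
      then have "((\<lambda>t. ?r ((\<phi> \<circ> \<alpha>) t)) has_vector_derivative D ?r (\<phi> (\<alpha> t)) (v t)) (at t)"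
        by (simp add: has_vector_derivative_def linear_cmul[OF smooth_on_linear(1)[OF r xU[OF t]]])
      then show ?thesis
        by (rule has_vector_derivative_transform_within_open[OF _ J t]) (use c(1) in \<open>simp add: J_def\<close>)
    qed
    have E: "E t = D ?r (\<phi> (\<alpha> t)) (v t)" if "t \<in> J" for t
      unfolding E_def using dE[OF that] by (rule vector_derivative_at)
    have "continuous_on J (\<lambda>t. v t $ 1 *\<^sub>R D ?r (\<phi> (\<alpha> t)) (axis 1 1) + v t $ 2 *\<^sub>R D ?r (\<phi> (\<alpha> t)) (axis 2 1))"
      using smooth_on_continuous(1)[OF sm] xU
      by (intro continuous_intros cv continuous_on_compose2[OF smooth_on_continuous(2)[OF r]]) (auto simp: o_def)
    moreover have "E t = v t $ 1 *\<^sub>R D ?r (\<phi> (\<alpha> t)) (axis 1 1) + v t $ 2 *\<^sub>R D ?r (\<phi> (\<alpha> t)) (axis 2 1)"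
      if "t \<in> J" for t
      unfolding E[OF that] by (rule linear_vec2[OF smooth_on_linear(1)[OF r xU[OF that]]])
    ultimately have "continuous_on J E" by (simp cong: continuous_on_cong)
    then have cE: "isCont E t" using J tJ by (simp add: continuous_on_eq_continuous_at)
    have "v t \<noteq> 0"
    proof -
      have "\<forall>(U, \<phi>)\<in>A. smooth_on (\<phi> \<circ> \<alpha>) {t\<in>UNIV. \<alpha> t \<in> U} \<and>
          (\<forall>t\<in>UNIV. \<alpha> t \<in> U \<longrightarrow> vector_derivative (\<phi> \<circ> \<alpha>) (at t) \<noteq> 0)"
        using \<alpha> unfolding asymptotic_curve_def regular_curve_def by (elim conjE)
      from bspec[OF this c(1)] show ?thesis using c(2) vd[OF tJ] by auto
    qed
    moreover have "second_form ?r (\<phi> (\<alpha> t)) (v t) (v t) = 0"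
    proof -
      have "\<forall>(U, \<phi>)\<in>A. \<forall>t\<in>UNIV. \<alpha> t \<in> U \<longrightarrow> (let v = vector_derivative (\<phi> \<circ> \<alpha>) (at t)
         in second_form (local_param f (U, \<phi>)) (\<phi> (\<alpha> t)) v v = 0)"
        using \<alpha> unfolding asymptotic_curve_def by (elim conjE)
      from bspec[OF this c(1)] show ?thesis using c(2) vd[OF tJ] by (auto simp: Let_def)
    qed
    ultimately have "asym_type 1 ?r (\<phi> (\<alpha> t)) (v t) \<or> asym_type (-1) ?r (\<phi> (\<alpha> t)) (v t)"
      by (intro asymptotic_vector_has_type[OF r xU[OF tJ] chart(7)[OF c(1) xU[OF tJ]]])
    then have "asym_dir 1 (\<alpha> t) (E t) \<or> asym_dir (-1) (\<alpha> t) (E t)"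
      using asym_dirI[OF c] unfolding E[OF tJ] by blast
    then show ?thesis using cE dE[OF tJ] E[OF tJ] by simp
  qed
  show ?thesis
  proof (rule that[of E])
    show "continuous_on UNIV E" using local by (simp add: continuous_at_imp_continuous_on)
  qed (use local in auto)
qed

section \<open>Closed asymptotic curves\<close>

text \<open>The charts of the surface are carried over to the plane by the homeomorphism \<open>h\<close>.  They are merely
homeomorphisms onto open subsets of the plane, but composed with the immersion they are smooth.\<close>

lemma plane_chart:
  fixes h :: "'a \<Rightarrow> complex"
  assumes hk: "homeomorphic_maps X euclidean h k" and c: "(U, \<phi>) \<in> A"
  defines "W \<equiv> {q. k q \<in> U}" and "\<kappa> \<equiv> \<lambda>x. h (inv_into U \<phi> x)" and "\<psi> \<equiv> \<lambda>q. \<phi> (k q)"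
  shows "open W" and "homeomorphism (\<phi> ` U) W \<kappa> \<psi>"
    and "\<And>x. x \<in> \<phi> ` U \<Longrightarrow> f (k (\<kappa> x)) = local_param f (U, \<phi>) x"
proof -
  have conth: "continuous_map X euclidean h" and contk: "continuous_map euclidean X k"
    and hk1: "\<And>x. x \<in> topspace X \<Longrightarrow> k (h x) = x" and kh1: "\<And>q. h (k q) = q"
    using hk by (auto simp: homeomorphic_maps_def)
  have UX: "U \<subseteq> topspace X" using openin_subset[OF chart(1)[OF c]] .
  show "open W"
    using openin_continuous_map_preimage[OF contk chart(1)[OF c]] by (simp add: W_def)
  have inv: "inv_into U \<phi> (\<phi> p) = p" if "p \<in> U" for p using chart(3)[OF c] that by simp
  have hm: "continuous_map (subtopology X U) (top_of_set (\<phi> ` U)) \<phi>"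
    "continuous_map (top_of_set (\<phi> ` U)) (subtopology X U) (inv_into U \<phi>)"
    using chart(4)[OF c] by (auto simp: homeomorphic_maps_def)
  have "continuous_map (top_of_set (\<phi> ` U)) euclidean (h \<circ> inv_into U \<phi>)"
    by (rule continuous_map_compose[OF hm(2) continuous_map_from_subtopology[OF conth]])
  then have c\<kappa>: "continuous_on (\<phi> ` U) \<kappa>"
    by (simp add: \<kappa>_def o_def)
  have "continuous_map (top_of_set W) (subtopology X U) k"
    by (rule continuous_map_into_subtopology[OF continuous_map_from_subtopology[OF contk]])
       (auto simp: W_def)
  from continuous_map_compose[OF this hm(1)]
  have "continuous_map (top_of_set W) (top_of_set (\<phi> ` U)) \<psi>"
    by (simp add: \<psi>_def o_def)
  then have "continuous_map (top_of_set W) euclidean \<psi>"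
    by (simp add: continuous_map_in_subtopology)
  then have c\<psi>: "continuous_on W \<psi>" by simp
  show "homeomorphism (\<phi> ` U) W \<kappa> \<psi>"
  proof (rule homeomorphismI[OF c\<kappa> c\<psi>])
    show "\<kappa> ` \<phi> ` U \<subseteq> W" using inv hk1 UX by (auto simp: \<kappa>_def W_def subset_iff)
    show "\<psi> ` W \<subseteq> \<phi> ` U" by (auto simp: \<psi>_def W_def)
    show "\<psi> (\<kappa> x) = x" if "x \<in> \<phi> ` U" for x
      using that inv hk1 UX by (auto simp: \<kappa>_def \<psi>_def subset_iff)
    show "\<kappa> (\<psi> q) = q" if "q \<in> W" for q
      using that inv kh1 by (auto simp: \<kappa>_def \<psi>_def W_def)
  qed
  show "f (k (\<kappa> x)) = local_param f (U, \<phi>) x" if "x \<in> \<phi> ` U" for x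
    using that inv hk1 UX by (auto simp: \<kappa>_def local_param_def subset_iff)
qed

text \<open>An arbitrary choice of unit vectors of type \<open>s\<close> is locally continuous up to sign.\<close>

lemma asymptotic_unit_field:
  fixes h :: "'a \<Rightarrow> complex"
  assumes hk: "homeomorphic_maps X euclidean h k" and s: "s = 1 \<or> s = -1"
  shows "\<exists>u. continuous_on (cball 0 R) u \<and> (\<forall>p\<in>cball 0 R. norm (u p) = 1 \<and> asym_dir s (k p) (u p))"
proof -
  have kX: "k p \<in> topspace X" for p
    using hk by (auto simp: homeomorphic_maps_def continuous_map_def)
  define e where "e = (\<lambda>p. SOME e. asym_dir s (k p) e)"
  have e: "asym_dir s (k p) (e p)" for p
    unfolding e_def using asym_dir_exists[OF kX s] by (rule someI_ex)
  define g where "g = (\<lambda>p. sgn (e p))"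
  have e0: "e p \<noteq> 0" for p using asym_dir_nonzero[OF e] .
  have g: "asym_dir s (k p) (g p)" "norm (g p) = 1" for p
    using asym_dir_scale[OF e, of "inverse (norm (e p))" p] e0[of p]
    by (simp_all add: g_def sgn_div_norm)
  have "\<exists>N e. open N \<and> p \<in> N \<and> continuous_on N e \<and> (\<forall>q\<in>N. e q = g q \<or> e q = - g q)" for p
  proof -
    obtain U \<phi> where c: "(U, \<phi>) \<in> A" "k p \<in> U" by (rule chart_covers[OF kX])
    obtain B e where B: "open B" "\<phi> (k p) \<in> B" "B \<subseteq> \<phi> ` U" "continuous_on B e"
      "\<And>x. x \<in> B \<Longrightarrow> asym_dir s (inv_into U \<phi> x) (e x)"
      using asym_dir_local_field[OF c s] by blast
    define W \<psi> where "W = {q. k q \<in> U}" and "\<psi> = (\<lambda>q. \<phi> (k q))"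
    have W: "open W" "continuous_on W \<psi>"
      using plane_chart(1,2)[OF hk c(1)] by (simp_all add: W_def \<psi>_def homeomorphism_def)
    define N where "N = W \<inter> \<psi> -` B"
    have N: "open N" unfolding N_def by (rule continuous_open_preimage[OF W(2,1) B(1)])
    have eN: "asym_dir s (k q) (e (\<psi> q))" if "q \<in> N" for q
    proof -
      have "inv_into U \<phi> (\<psi> q) = k q"
        using that chart(3)[OF c(1)] by (simp add: N_def W_def \<psi>_def)
      then show ?thesis using B(5)[of "\<psi> q"] that by (simp add: N_def)
    qed
    have "continuous_on N (\<lambda>q. e (\<psi> q))"
      by (rule continuous_on_compose2[OF B(4) continuous_on_subset[OF W(2)]]) (auto simp: N_def)
    then have "continuous_on N (\<lambda>q. sgn (e (\<psi> q)))"
      by (rule continuous_on_sgn) (use asym_dir_nonzero[OF eN] in blast)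
    moreover have "sgn (e (\<psi> q)) = g q \<or> sgn (e (\<psi> q)) = - g q" if qN: "q \<in> N" for q
    proof -
      obtain m where m: "m \<noteq> 0" "e (\<psi> q) = m *\<^sub>R g q"
        using asym_dir_parallel[OF g(1) eN[OF qN]] by blast
      have "sgn (g q) = g q" using g(2)[of q] by (simp add: sgn_div_norm)
      then show ?thesis using m by (cases "m > 0") (auto simp: sgn_scaleR)
    qed
    moreover have "p \<in> N" using c B(2) by (simp add: N_def W_def \<psi>_def)
    ultimately show ?thesis using N by blast
  qed
  from continuous_sign_choice[of g, OF g(2) this, of R]
  obtain u where u: "continuous_on (cball 0 R) u" "\<And>p. p \<in> cball 0 R \<Longrightarrow> u p = g p \<or> u p = - g p"
    by blast
  have "norm (u p) = 1 \<and> asym_dir s (k p) (u p)" if "p \<in> cball 0 R" for p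
    using u(2)[OF that] g[of p] asym_dir_scale[OF g(1), of "-1" p] by auto
  then show ?thesis using u(1) by blast
qed

text \<open>The type of the velocity is constant because both types are closed conditions: the curve is of type
\<open>s\<close> at \<open>t\<close> if and only if equality holds in the Cauchy-Schwarz inequality for the velocity and the
unit field of type \<open>s\<close>.\<close>

lemma no_closed_asymptotic_curve:
  fixes h :: "'a \<Rightarrow> complex"
  assumes hk: "homeomorphic_maps X euclidean h k" and closed: "closed_asymptotic_curve X A f l \<alpha>"
  shows False
proof -
  have l: "l > 0" and per: "\<And>t. \<alpha> (t + l) = \<alpha> t" and \<alpha>: "asymptotic_curve X A f UNIV \<alpha>"
    using closed by (auto simp: closed_asymptotic_curve_def)
  have cont\<alpha>: "continuous_map euclidean X \<alpha>"
    using \<alpha> by (simp add: asymptotic_curve_def regular_curve_def)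
  obtain E where E: "\<And>t. ((\<lambda>t. f (\<alpha> t)) has_vector_derivative E t) (at t)"
    "continuous_on UNIV E" "\<And>t. asym_dir 1 (\<alpha> t) (E t) \<or> asym_dir (-1) (\<alpha> t) (E t)"
    using asymptotic_curve_velocity[OF \<alpha>] by blast
  have conth: "continuous_map X euclidean h" and kX: "\<And>p. k p \<in> topspace X"
    and hk1: "\<And>x. x \<in> topspace X \<Longrightarrow> k (h x) = x" and kh1: "\<And>q. h (k q) = q"
    using hk by (auto simp: homeomorphic_maps_def continuous_map_def)
  define a where "a = (\<lambda>t. h (\<alpha> t))"
  have conta: "continuous_on UNIV a"
    using continuous_map_compose[OF cont\<alpha> conth] by (simp add: a_def o_def)
  have ka: "k (a t) = \<alpha> t" for t
    using cont\<alpha> hk1 by (auto simp: a_def continuous_map_def)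
  have pera: "a (t + l) = a t" for t by (simp add: a_def per)
  obtain R where R: "range a \<subseteq> cball 0 R"
  proof -
    have "a t \<in> a ` {0..l}" for t
      using periodic_int_multiple[of a l, OF pera, of t "- \<lfloor>t / l\<rfloor>"] reduce_mod_period[OF l, of t]
      by (metis imageI)
    moreover have "bounded (a ` {0..l})"
      by (intro compact_imp_bounded compact_continuous_image continuous_on_subset[OF conta]) auto
    ultimately have "bounded (range a)" by (metis bounded_subset image_subsetI)
    then show ?thesis using that by (auto simp: bounded_iff subset_iff)
  qed
  have aR: "a t \<in> cball 0 (R + 1)" for t
  proof -
    have "a t \<in> cball 0 R" using R by blast
    then show ?thesis by simp
  qed
  have ext: "continuous_on UNIV (\<lambda>t. u (a t))" if "continuous_on (cball 0 (R + 1)) u" for u :: "complex \<Rightarrow> real^3"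
    by (rule continuous_on_compose2[OF that conta]) (use aR in auto)
  have "\<forall>s\<in>{1,-1}. \<exists>u. continuous_on (cball 0 (R + 1)) u \<and>
      (\<forall>p\<in>cball 0 (R + 1). norm (u p) = 1 \<and> asym_dir s (k p) (u p))"
    by (intro ballI asymptotic_unit_field[OF hk]) auto
  from bchoice[OF this] obtain w where "\<forall>s\<in>{1,-1}. continuous_on (cball 0 (R + 1)) (w s) \<and>
      (\<forall>p\<in>cball 0 (R + 1). norm (w s p) = 1 \<and> asym_dir s (k p) (w s p))" by blast
  then have w: "\<And>s. s = 1 \<or> s = -1 \<Longrightarrow> continuous_on (cball 0 (R + 1)) (w s)"
    "\<And>s p. s = 1 \<or> s = -1 \<Longrightarrow> p \<in> cball 0 (R + 1) \<Longrightarrow> norm (w s p) = 1 \<and> asym_dir s (k p) (w s p)"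
    by blast+
  define Z where "Z = (\<lambda>s. {t. \<bar>E t \<bullet> w s (a t)\<bar> = norm (E t)})"
  have E0: "E t \<noteq> 0" for t using E(3)[of t] asym_dir_nonzero by blast
  have Z: "t \<in> Z s \<longleftrightarrow> asym_dir s (\<alpha> t) (E t)" if s: "s = 1 \<or> s = -1" for s t
  proof
    have wt: "norm (w s (a t)) = 1" "asym_dir s (\<alpha> t) (w s (a t))"
      using w(2)[OF s aR[of t]] ka[of t] by auto
    {
      assume "t \<in> Z s"
      then have "\<bar>E t \<bullet> w s (a t)\<bar> = norm (E t) * norm (w s (a t))" using wt by (simp add: Z_def)
      then have "E t = norm (E t) *\<^sub>R w s (a t) \<or> E t = (- norm (E t)) *\<^sub>R w s (a t)"
        unfolding norm_cauchy_schwarz_abs_eq using wt(1) by (auto simp: minus_equation_iff)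
      then show "asym_dir s (\<alpha> t) (E t)"
        using asym_dir_scale[OF wt(2), of "norm (E t)"] asym_dir_scale[OF wt(2), of "- norm (E t)"] E0[of t]
        by (metis neg_equal_0_iff_equal norm_eq_zero)
    next
      assume "asym_dir s (\<alpha> t) (E t)"
      from asym_dir_parallel[OF wt(2) this] obtain c where c: "E t = c *\<^sub>R w s (a t)" by blast
      have "w s (a t) \<bullet> w s (a t) = 1" using wt(1) by (simp add: dot_square_norm)
      then show "t \<in> Z s" using wt(1) by (simp add: Z_def c)
    }
  qed
  have closedZ: "closed (Z s)" if s: "s = 1 \<or> s = -1" for s
    unfolding Z_def by (intro closed_Collect_eq continuous_intros E(2) ext w(1) s)
  have Z1: "t \<in> Z 1 \<longleftrightarrow> asym_dir 1 (\<alpha> t) (E t)" for t by (rule Z) simp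
  have Zm: "t \<in> Z (-1) \<longleftrightarrow> asym_dir (-1) (\<alpha> t) (E t)" for t by (rule Z) simp
  have "Z 1 = {} \<or> Z (-1) = {}"
  proof -
    have "UNIV \<subseteq> Z 1 \<union> Z (-1)" using E(3) Z1 Zm by blast
    moreover have "Z 1 \<inter> Z (-1) \<inter> UNIV = {}" using asym_dir_unique_sign Z1 Zm by blast
    moreover have "closed (Z 1)" "closed (Z (-1))" by (simp_all add: closedZ)
    ultimately show ?thesis
      using connected_UNIV[where 'a = real, unfolded connected_closed] by (metis Int_UNIV_right)
  qed
  then have "(\<forall>t. asym_dir 1 (\<alpha> t) (E t)) \<or> (\<forall>t. asym_dir (-1) (\<alpha> t) (E t))"
    using E(3) Z1 Zm by (metis empty_iff)
  then obtain s where s: "s = 1 \<or> s = -1" "\<And>t. asym_dir s (\<alpha> t) (E t)" by metis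
  define y where "y = (\<lambda>t. E t \<bullet> w s (a t))"
  have conty: "continuous_on UNIV y" unfolding y_def by (intro continuous_intros E(2) ext w(1) s(1))
  have y0: "y t \<noteq> 0" for t
    using Z[OF s(1), of t] s(2)[of t] E0[of t] by (auto simp: Z_def y_def)
  \<comment> \<open>The field is reversed if the curve runs against it.\<close>
  define \<eta> where "\<eta> = sgn (y 0)"
  have \<eta>: "\<eta> = 1 \<or> \<eta> = -1" using y0[of 0] by (simp add: \<eta>_def sgn_if)
  have pos: "\<eta> * y t > 0" for t
  proof (rule ccontr)
    assume "\<not> ?thesis"
    then have "\<eta> * y t \<le> 0" by simp
    moreover have "0 \<le> \<eta> * y 0" by (simp add: \<eta>_def sgn_if)
    moreover have "connected (range (\<lambda>t. \<eta> * y t))"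
      by (intro connected_continuous_image continuous_intros conty connected_UNIV)
    ultimately have "0 \<in> range (\<lambda>t. \<eta> * y t)" using connectedD_interval by blast
    then show False using y0 \<eta> by auto
  qed
  define u where "u = (\<lambda>p. \<eta> *\<^sub>R w s p)"
  have u: "continuous_on (cball 0 (R + 1)) u" unfolding u_def by (intro continuous_intros w(1) s(1))
  have unit: "norm (u p) = 1" "asym_dir s (k p) (u p)" if "p \<in> cball 0 (R + 1)" for p
    using w(2)[OF s(1) that] \<eta> asym_dir_scale[of s "k p" "w s p" \<eta>] by (auto simp: u_def)
  have Eu: "E t \<bullet> u (a t) > 0" for t using pos[of t] by (simp add: u_def y_def)
  define F where "F = (\<lambda>p. f (k p))"
  have "\<exists>G. displacement G \<and> (\<forall>q\<in>cball 0 R. strictly_advances F u G q)"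
  proof (rule compact_strictly_advancing[of _ "ball 0 (R + 1)"])
    show "cball 0 R \<subseteq> ball (0::complex) (R + 1)" by auto
    fix p :: complex assume "p \<in> cball 0 R"
    then have p: "p \<in> cball 0 (R + 1)" "p \<in> ball 0 (R + 1)" by auto
    obtain U \<phi> where c: "(U, \<phi>) \<in> A" "k p \<in> U" by (rule chart_covers[OF kX])
    let ?r = "local_param f (U, \<phi>)"
    note r = chart(5)[OF c(1)]
    note pc = plane_chart[OF hk c(1)]
    have x: "\<phi> (k p) \<in> \<phi> ` U" using c by blast
    have \<kappa>: "h (inv_into U \<phi> (\<phi> (k p))) = p" using chart(3)[OF c(1)] c(2) kh1 by simp
    obtain v where v: "u p = D ?r (\<phi> (k p)) v" by (rule asym_dir_in_chart[OF unit(2)[OF p(1)] c])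
    have "\<exists>G N. displacement G \<and> open N \<and> h (inv_into U \<phi> (\<phi> (k p))) \<in> N \<and>
        (\<forall>q\<in>ball 0 (R + 1). weakly_advances F u G q) \<and> (\<forall>q\<in>N. strictly_advances F u G q)"
    proof (rule chart_displacement[OF chart(2)[OF c(1)] x pc(1,2) open_ball])
      show "h (inv_into U \<phi> (\<phi> (k p))) \<in> ball 0 (R + 1)" using \<kappa> p by simp
      show "continuous_on (ball 0 (R + 1)) u" by (rule continuous_on_subset[OF u]) auto
      show "((\<lambda>x. F (h (inv_into U \<phi> x))) has_derivative D ?r x) (at x)" if "x \<in> \<phi> ` U" for x
        by (rule has_derivative_transform_within_open[OF smooth_on_has_derivative(1)[OF r that] chart(2)[OF c(1)] that])
           (simp add: F_def pc(3))
      show "continuous_on (\<phi> ` U) (\<lambda>x. D ?r x v)" for v by (rule smooth_on_continuous(2)[OF r])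
      show "D ?r (\<phi> (k p)) v \<bullet> u (h (inv_into U \<phi> (\<phi> (k p)))) > 0"
        unfolding \<kappa> v[symmetric] using unit(1)[OF p(1)] by (simp add: dot_square_norm)
    qed
    then show "\<exists>G N. displacement G \<and> open N \<and> p \<in> N \<and>
        (\<forall>q\<in>ball 0 (R + 1). weakly_advances F u G q) \<and> (\<forall>q\<in>N. strictly_advances F u G q)"
      unfolding \<kappa> .
  qed simp
  then obtain G where G: "displacement G" "\<And>q. q \<in> cball 0 R \<Longrightarrow> strictly_advances F u G q" by blast
  show False
  proof (rule no_closed_advancing_curve[OF compact_cball convex_cball G l pera conta R])
    fix t0
    have "continuous_on UNIV (\<lambda>t. E t \<bullet> u (a t0))" by (intro continuous_intros E(2))
    then have "open {t. E t \<bullet> u (a t0) > 0}"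
      by (intro open_Collect_less continuous_on_const)
    moreover have "t0 \<in> {t. E t \<bullet> u (a t0) > 0}" using Eu by simp
    ultimately obtain d where d: "d > 0" "ball t0 d \<subseteq> {t. E t \<bullet> u (a t0) > 0}" by (rule openE)
    have "0 < (F (a t) - F (a s)) \<bullet> u (a t0)" if st: "s < t" "dist s t0 < d" "dist t t0 < d" for s t
    proof -
      have "f (\<alpha> s) \<bullet> u (a t0) < f (\<alpha> t) \<bullet> u (a t0)"
      proof (rule DERIV_pos_imp_increasing[OF st(1)])
        fix z assume "s \<le> z" "z \<le> t"
        then have "z \<in> ball t0 d" using st by (auto simp: dist_real_def abs_if split: if_splits)
        then have "E z \<bullet> u (a t0) > 0" using d(2) by blast
        moreover have "((\<lambda>t. f (\<alpha> t) \<bullet> u (a t0)) has_real_derivative E z \<bullet> u (a t0)) (at z)"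
          using has_derivative_inner_left[OF E(1)[of z, unfolded has_vector_derivative_def], of "u (a t0)"]
          by (simp add: has_field_derivative_def mult_commute_abs)
        ultimately show "\<exists>y. ((\<lambda>t. f (\<alpha> t) \<bullet> u (a t0)) has_real_derivative y) (at z) \<and> 0 < y" by blast
      qed
      then show ?thesis by (simp add: F_def ka inner_diff_left)
    qed
    then show "\<exists>d>0. \<forall>s t. s < t \<and> dist s t0 < d \<and> dist t t0 < d \<longrightarrow> 0 < (F (a t) - F (a s)) \<bullet> u (a t0)"
      using d(1) by blast
  qed
qed

end

theorem proposition1p1:
  fixes X :: "'a topology" and A :: "'a chart set" and f :: "'a \<Rightarrow> real^3"
  assumes "regular_surface X A f"
    and "X homeomorphic_space (euclidean :: (real^2) topology)"
    and "\<forall>(U, \<phi>)\<in>A. \<forall>p\<in>U. gauss_curvature (local_param f (U, \<phi>)) (\<phi> p) < 0"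
  shows "\<not> (\<exists>l \<alpha>. closed_asymptotic_curve X A f l \<alpha>)"
proof -
  have "(UNIV :: (real^2) set) homeomorphic (UNIV :: complex set)"
    by (simp add: homeomorphic_UNIV_UNIV)
  then obtain i :: "real^2 \<Rightarrow> complex" and j where "homeomorphism UNIV UNIV i j"
    unfolding homeomorphic_def by blast
  then have "homeomorphic_maps euclidean euclidean i j"
    by (simp add: homeomorphism_def homeomorphic_maps_def)
  then have "X homeomorphic_space (euclidean :: complex topology)"
    using assms(2) homeomorphic_space_trans unfolding homeomorphic_space_def by blast
  then obtain h :: "'a \<Rightarrow> complex" and k where hk: "homeomorphic_maps X euclidean h k"
    unfolding homeomorphic_space_def by blast
  interpret negative_surface X A f by unfold_locales fact+
  show ?thesis using no_closed_asymptotic_curve[OF hk] by blast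
qed

end
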